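(* Let $P,\mathcal{E}_1,\mathcal{E}_2,Q_1,Q_2$ be probabilistic concurrent programs over a finite state space $\Omega$, and let $r_1,r_2,g_1,g_2\in\mathbb{H}_1\Omega$ with $r_1\cap r_2\in\mathbb{H}_1\Omega$, where $(r_1\cap r_2)(s)=r_1(s)\cap r_2(s)$. Suppose $$\{P\ r_1^{*}\}\,\mathcal{E}_1\,\{g_1^{*}\ Q_1\},\qquad\{P\ r_2^{*}\}\,\mathcal{E}_2\,\{g_2^{*}\ Q_2\},\qquad g_1\sqsubseteq_{\mathbb{H}}r_2,\qquad g_2\sqsubseteq_{\mathbb{H}}r_1.$$ Then $$\{P\ (r_1\cap r_2)^{*}\}\,\mathcal{E}_1\|\mathcal{E}_2\,\{(g_1+g_2)^{*}\ Q_1\},$$ where $g_1+g_2$ is the nondeterministic choice in $\mathbb{H}_1\Omega$.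
   Context: **Programs.** $\Omega$ is a fixed finite set of states. $\mathbb{D}\Omega$ is the set of distributions on $\Omega$, viewed inside $\mathbb{R}^\Omega$; $\mathbb{D}_{\le 1}\Omega$ is the set of subdistributions; $\delta_s$ is the point distribution at $s$. $\mathbb{H}_1\Omega$ is the set of maps $r:\Omega\to\mathcal{P}(\mathbb{D}\Omega)$ such that each $r(s)$ is non-empty, convex and topologically closed. A test is a map $b:\Omega\to\mathcal{P}(\mathbb{D}\Omega)$ with $b(s)\subseteq\{\delta_s\}$. $\overline{\mathbb{H}}_1\Omega$ is $\mathbb{H}_1\Omega$ together with all tests, ordered by $r\sqsubseteq_{\mathbb{H}}r'$ iff $r(s)\subseteq r'(s)$ for all $s$. $\delta$ denotes the program $\delta(s)=\{\delta_s\}$. On $\mathbb{H}_1\Omega$, $(g+g')(s)=\{(1-p)\mu+p\mu':p\in[0,1],\mu\in g(s),\mu'\in g'(s)\}$. **ipBES.** A bundle event structure with internal probability (ipBES) is $\mathcal{E}=(E,\mapsto,\#,\lambda,\mathbf{\Phi})$ where $E$ is a set of events; $\#$ is an irreflexive symmetric relation on $E$; for $x,x'\subseteq E$, $x\#x'$ means $e\#e'$ for all $e\in x,e'\in x'$ with $e\ne e'$; $\mapsto\subseteq\mathcal{P}(E)\times E$ satisfies $x\#x$ whenever $x\mapsto e$; $\lambda:E\to\overline{\mathbb{H}}_1\Omega$; $\mathbf{\Phi}\subseteq\mathcal{P}(E)$ with $x\#x$ for $x\in\mathbf{\Phi}$. $\mathbf{in}(\mathcal{E})$ is the set of initial events,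 i.e. events $e$ with no bundle $x\mapsto e$. **Traces.** A finite trace is a finite sequence $e_1\cdots e_n$ of distinct, pairwise non-conflicting events such that for every $j$ and every bundle $x\mapsto e_j$ there is $i<j$ with $e_i\in x$. $\mathcal{T}(\mathcal{E})$ is the set of finite traces (empty trace $\emptyset$), $\mathcal{T}_{\max}(\mathcal{E})$ the set of prefix-maximal ones. A trace $\alpha$ is weakly maximal if it is maximal or there are events $e_1,\dots,e_n$ with $\alpha e_1\cdots e_n\in\mathcal{T}_{\max}(\mathcal{E})$ and $\delta\sqsubseteq_{\mathbb{H}}\lambda(e_i)$ for all $i$. **Schedulers and semantics.** A scheduler $\sigma$ on $\mathcal{E}$ assigns to each $\alpha\in\mathcal{T}(\mathcal{E})$ a partial function $\sigma(\alpha):E\times\Omega\rightharpoonup\mathbb{D}_{\le1}\Omega$ with domain $\{(e,s):\alpha e\in\mathcal{T}(\mathcal{E}),\,s\in\Omega\}$ for which there is $w:E\times\Omega\to[0,1]$ (depending on $\alpha$) such that for $(e,s)$ in the domain: if $\lambda(e)(s)\neq\emptyset$ then $\sigma(\alpha)(e,s)=w(e,s)\mu$ for some $\mu\in\lambda(e)(s)$; if $\lambda(e)(s)=\emptyset$ then $w(e,s)=0$ and $\sigma(\alpha)(e,s)=0$; and, when the domain is non-empty, $\sum_{e:\alpha e\in\mathcal{T}(\mathcal{E})}w(e,s)=1$ for every $s$. From initial state $s$, define $\varphi_s(\emptyset)=\delta_s$, $\varphi_s(\alpha e)(u)=\sum_{t\in\Omega}\sigma(\alpha)(e,t)(u)\varphi_s(\alpha)(t)$,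 and $\sigma_s(\mathcal{E})=\sum_{\alpha\in\mathcal{T}_{\max}(\mathcal{E})}\varphi_s(\alpha)$. $\mathbf{Sched}_1(\mathcal{E})$ is the set of schedulers $\sigma$ such that $\sigma_s(\mathcal{E})$ is a distribution for every $s$. $\mathcal{E}$ is feasible if for every $\alpha\in\mathcal{T}(\mathcal{E})\setminus\mathcal{T}_{\max}(\mathcal{E})$, $\bigcup_{\alpha e\in\mathcal{T}(\mathcal{E})}\{s:\lambda(e)(s)\ne\emptyset\}=\Omega$; it is terminating if $\mathbf{Sched}_1(\mathcal{E})\neq\emptyset$. $[\![\mathcal{E}]\!](s)$ is the topological closure of the convex hull of $\{\sigma_s(\mathcal{E}):\sigma\in\mathbf{Sched}_1(\mathcal{E})\}$, and $\mathcal{E}\sqsubseteq\mathcal{F}$ means $[\![\mathcal{E}]\!]\sqsubseteq_{\mathbb{H}}[\![\mathcal{F}]\!]$. A probabilistic concurrent program is a feasible and terminating ipBES. **t-simulation.** A function $f:\mathcal{T}(\mathcal{E})\to\mathcal{T}(\mathcal{F})$ is a t-simulation if: (i) $f(\emptyset)=\emptyset$ and $f^{-1}(\beta)$ is finite for every $\beta\in\mathcal{T}(\mathcal{F})$; (ii) if $\alpha e\in\mathcal{T}(\mathcal{E})$ then either $f(\alpha e)=f(\alpha)$ and $\lambda(e)\sqsubseteq_{\mathbb{H}}\delta$, or there is an event $e'$ of $\mathcal{F}$ with $\lambda(e)\sqsubseteq_{\mathbb{H}}\lambda(e')$ and $f(\alpha e)=f(\alpha)e'$; (iii) if $\alpha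 e$ is maximal in $\mathcal{T}(\mathcal{E})$ then $f(\alpha e)=f(\alpha)e'$ for some $e'$ with $\lambda(e)\sqsubseteq_{\mathbb{H}}\lambda(e')$, and $f(\alpha e)$ is weakly maximal in $\mathcal{T}(\mathcal{F})$. $\mathcal{E}\sqsubseteq_{\mathrm{sim}}\mathcal{F}$ means there is a t-simulation from $\mathcal{E}$ to $\mathcal{F}$. **Operations on ipBES** (event sets of the operands are taken disjoint, using fresh copies if necessary). - An atomic action $a\in\overline{\mathbb{H}}_1\Omega$ is identified with the structure with one event $e$ labelled $a$, no bundles, no conflicts, and $\mathbf{\Phi}=\{\{e\}\}$; $1$ is the structure of the atomic action $\delta$. $0$ is the structure with no events and $\mathbf{\Phi}=\emptyset$; by convention $0\cdot\mathcal{E}=\mathcal{E}\cdot0=\mathcal{E}$. - $\mathcal{E}\cdot\mathcal{F}$ has events $E\cup F$, conflict $\#_{\mathcal{E}}\cup\#_{\mathcal{F}}$, bundles $\mapsto_{\mathcal{E}}\cup\mapsto_{\mathcal{F}}\cup\{x\mapsto e: x\in\mathbf{\Phi}_{\mathcal{E}},e\in\mathbf{in}(\mathcal{F})\}$, labels $\lambda_{\mathcal{E}}\cup\lambda_{\mathcal{F}}$, exit sets $\mathbf{\Phi}_{\mathcal{F}}$. - $\mathcal{E}\|\mathcal{F}=(E\cup F,\ \mapsto_{\mathcal{E}}\cup\mapsto_{\mathcal{F}},\ \#_{\mathcal{E}}\cup\#_{\mathcal{F}},\ \lambda_{\mathcal{E}}\cup\lambda_{\mathcal{F}},\ \mathbf{\Phi}_{\mathcal{E}}\cup\mathbf{\Phi}_{\mathcal{F}})$.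 - For $r\in\mathbb{H}_1\Omega$, $r^{*}=r*1$ is the limit of the sequence $1,\ 1+r\cdot1,\ 1+r\cdot(1+r\cdot 1),\dots$ (with $+$ the nondeterministic choice of event structures). Explicitly it has events $a_k$ (label $r$) and $d_k$ (label $\delta$), $k\ge0$; bundles $\{a_k\}\mapsto a_{k+1}$ and $\{a_k\}\mapsto d_{k+1}$; conflicts $a_k\#d_k$ for all $k$ and $d_j\#d_k$ for $j\neq k$; and the single exit set $\{d_k:k\ge0\}$. **Rely-guarantee.** A probabilistic rely or guarantee condition is a probabilistic concurrent program $R$ with $R\|R\sqsubseteq_{\mathrm{sim}}R$; every $r^{*}$ is one. The quintuple $\{P\ R\}\,\mathcal{E}\,\{G\ Q\}$ is (by definition) the assertion $P\cdot(R\|\mathcal{E})\sqsubseteq Q$ and $\mathcal{E}\sqsubseteq_{\mathrm{sim}}G$. *)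

theory Defs
  imports "HOL-Analysis.Analysis" "HOL-Library.Sublist"
begin

section \<open>Probabilistic programs over a finite state space\<close>

type_synonym 's prog = "'s \<Rightarrow> (real ^ 's) set"

definition dists :: "(real ^ 's) set" where
  "dists = {\<mu>. (\<forall>u. 0 \<le> \<mu> $ u) \<and> (\<Sum>u\<in>UNIV. \<mu> $ u) = 1}"

definition subdists :: "(real ^ 's) set" where
  "subdists = {\<mu>. (\<forall>u. 0 \<le> \<mu> $ u) \<and> (\<Sum>u\<in>UNIV. \<mu> $ u) \<le> 1}"

definition point :: "'s \<Rightarrow> real ^ 's" where
  "point s = axis s 1"

definition H1 :: "'s::finite prog set" where
  "H1 = {r. \<forall>s. r s \<subseteq> dists \<and> r s \<noteq> {} \<and> convex (r s) \<and> closed (r s)}"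

definition tests :: "'s::finite prog set" where
  "tests = {b. \<forall>s. b s \<subseteq> {point s}}"

definition H1_bar :: "'s::finite prog set" where
  "H1_bar = H1 \<union> tests"

definition H_le :: "'s::finite prog \<Rightarrow> 's prog \<Rightarrow> bool" (infix "\<sqsubseteq>\<^sub>H" 50) where
  "r \<sqsubseteq>\<^sub>H r' \<longleftrightarrow> (\<forall>s. r s \<subseteq> r' s)"

definition skip :: "'s::finite prog" where
  "skip s = {point s}"

definition H_choice :: "'s::finite prog \<Rightarrow> 's prog \<Rightarrow> 's prog" (infixl "+\<^sub>H" 65) where
  "(g +\<^sub>H g') s = {(1 - p) *\<^sub>R \<mu> + p *\<^sub>R \<mu>' | p \<mu> \<mu>'. p \<in> {0..1} \<and> \<mu> \<in> g s \<and> \<mu>' \<in> g' s}"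


section \<open>Bundle event structures with internal probability\<close>

text \<open>The labelling is a total function on the type of events; only its values on
  the carrier \<open>events \<E>\<close> are meaningful.\<close>

record ('e, 's) ipbes =
  events :: "'e set"
  bundles :: "('e set \<times> 'e) set"
  conflict :: "('e \<times> 'e) set"
  label :: "'e \<Rightarrow> 's::finite prog"
  exits :: "'e set set"

definition conflicting_sets :: "('e, 's::finite) ipbes \<Rightarrow> 'e set \<Rightarrow> 'e set \<Rightarrow> bool" where
  "conflicting_sets \<E> x x' \<longleftrightarrow> (\<forall>e\<in>x. \<forall>e'\<in>x'. e \<noteq> e' \<longrightarrow> (e, e') \<in> conflict \<E>)"

definition is_ipbes :: "('e, 's::finite) ipbes \<Rightarrow> bool" where
  "is_ipbes \<E> \<longleftrightarrow>
     conflict \<E> \<subseteq> events \<E> \<times> events \<E> \<and> irrefl (conflict \<E>) \<and> sym (conflict \<E>) \<and>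
     bundles \<E> \<subseteq> Pow (events \<E>) \<times> events \<E> \<and>
     (\<forall>(x, e)\<in>bundles \<E>. conflicting_sets \<E> x x) \<and>
     (\<forall>e\<in>events \<E>. label \<E> e \<in> H1_bar) \<and>
     exits \<E> \<subseteq> Pow (events \<E>) \<and> (\<forall>x\<in>exits \<E>. conflicting_sets \<E> x x)"

definition initial_events :: "('e, 's::finite) ipbes \<Rightarrow> 'e set" where
  "initial_events \<E> = {e \<in> events \<E>. \<nexists>x. (x, e) \<in> bundles \<E>}"


subsection \<open>Traces\<close>

definition traces :: "('e, 's::finite) ipbes \<Rightarrow> 'e list set" where
  "traces \<E> = {\<alpha>. set \<alpha> \<subseteq> events \<E> \<and> distinct \<alpha> \<and>
     (\<forall>e\<in>set \<alpha>. \<forall>e'\<in>set \<alpha>. (e, e') \<notin> conflict \<E>) \<and>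
     (\<forall>j<length \<alpha>. \<forall>x. (x, \<alpha> ! j) \<in> bundles \<E> \<longrightarrow> (\<exists>i<j. \<alpha> ! i \<in> x))}"

definition max_traces :: "('e, 's::finite) ipbes \<Rightarrow> 'e list set" where
  "max_traces \<E> = {\<alpha> \<in> traces \<E>. \<forall>\<beta>\<in>traces \<E>. prefix \<alpha> \<beta> \<longrightarrow> \<beta> = \<alpha>}"

definition weakly_maximal :: "('e, 's::finite) ipbes \<Rightarrow> 'e list \<Rightarrow> bool" where
  "weakly_maximal \<E> \<alpha> \<longleftrightarrow> \<alpha> \<in> traces \<E> \<and>
     (\<alpha> \<in> max_traces \<E> \<or>
      (\<exists>es. \<alpha> @ es \<in> max_traces \<E> \<and> (\<forall>e\<in>set es. skip \<sqsubseteq>\<^sub>H label \<E> e)))"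


subsection \<open>Schedulers and semantics\<close>

type_synonym ('e, 's) scheduler = "'e list \<Rightarrow> 'e \<times> 's \<rightharpoonup> real ^ 's"

text \<open>A scheduler is only constrained on traces; its values on other lists are irrelevant.\<close>

definition is_scheduler :: "('e, 's::finite) ipbes \<Rightarrow> ('e, 's) scheduler \<Rightarrow> bool" where
  "is_scheduler \<E> \<sigma> \<longleftrightarrow> (\<forall>\<alpha>\<in>traces \<E>.
     dom (\<sigma> \<alpha>) = {(e, s). \<alpha> @ [e] \<in> traces \<E>} \<and> ran (\<sigma> \<alpha>) \<subseteq> subdists \<and>
     (\<exists>w :: 'e \<times> 's \<Rightarrow> real. range w \<subseteq> {0..1} \<and>
       (\<forall>(e, s)\<in>dom (\<sigma> \<alpha>).
          (label \<E> e s \<noteq> {} \<longrightarrow> (\<exists>\<mu>\<in>label \<E> e s. \<sigma> \<alpha> (e, s) = Some (w (e, s) *\<^sub>R \<mu>))) \<and>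
          (label \<E> e s = {} \<longrightarrow> w (e, s) = 0 \<and> \<sigma> \<alpha> (e, s) = Some 0)) \<and>
       (dom (\<sigma> \<alpha>) \<noteq> {} \<longrightarrow>
          (\<forall>s. ((\<lambda>e. w (e, s)) has_sum 1) {e. \<alpha> @ [e] \<in> traces \<E>}))))"

fun phi :: "('e, 's::finite) scheduler \<Rightarrow> 's \<Rightarrow> 'e list \<Rightarrow> real ^ 's" where
  "phi \<sigma> s [] = point s"
| "phi \<sigma> s (x # xs) =
     (let \<alpha> = butlast (x # xs); e = last (x # xs)
      in \<chi> u. \<Sum>t\<in>UNIV. the (\<sigma> \<alpha> (e, t)) $ u * phi \<sigma> s \<alpha> $ t)"

lemma phi_snoc:
  "phi \<sigma> s (\<alpha> @ [e]) = (\<chi> u. \<Sum>t\<in>UNIV. the (\<sigma> \<alpha> (e, t)) $ u * phi \<sigma> s \<alpha> $ t)"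
proof (cases "\<alpha> @ [e]")
  case (Cons x xs)
  then have "butlast (x # xs) = \<alpha>" "last (x # xs) = e"
    by (metis butlast_snoc, metis last_snoc)
  then show ?thesis
    unfolding Cons phi.simps by (simp only: Let_def)
qed simp

definition outcome :: "('e, 's::finite) ipbes \<Rightarrow> ('e, 's) scheduler \<Rightarrow> 's \<Rightarrow> real ^ 's" where
  "outcome \<E> \<sigma> s = (\<Sum>\<^sub>\<infinity>\<alpha>\<in>max_traces \<E>. phi \<sigma> s \<alpha>)"

definition Sched1 :: "('e, 's::finite) ipbes \<Rightarrow> ('e, 's) scheduler set" where
  "Sched1 \<E> = {\<sigma>. is_scheduler \<E> \<sigma> \<and> (\<forall>s. outcome \<E> \<sigma> s \<in> dists)}"

definition sem :: "('e, 's::finite) ipbes \<Rightarrow> 's prog" where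
  "sem \<E> s = closure (convex hull {outcome \<E> \<sigma> s | \<sigma>. \<sigma> \<in> Sched1 \<E>})"

definition sem_le :: "('e, 's::finite) ipbes \<Rightarrow> ('f, 's) ipbes \<Rightarrow> bool" (infix "\<sqsubseteq>" 50) where
  "\<E> \<sqsubseteq> \<F> \<longleftrightarrow> sem \<E> \<sqsubseteq>\<^sub>H sem \<F>"

definition feasible :: "('e, 's::finite) ipbes \<Rightarrow> bool" where
  "feasible \<E> \<longleftrightarrow> (\<forall>\<alpha>\<in>traces \<E> - max_traces \<E>.
     (\<Union>e\<in>{e. \<alpha> @ [e] \<in> traces \<E>}. {s. label \<E> e s \<noteq> {}}) = UNIV)"

definition terminating :: "('e, 's::finite) ipbes \<Rightarrow> bool" where
  "terminating \<E> \<longleftrightarrow> Sched1 \<E> \<noteq> {}"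

definition prob_concurrent_program :: "('e, 's::finite) ipbes \<Rightarrow> bool" where
  "prob_concurrent_program \<E> \<longleftrightarrow> is_ipbes \<E> \<and> feasible \<E> \<and> terminating \<E>"


subsection \<open>Simulation\<close>

definition t_simulation ::
    "('e, 's::finite) ipbes \<Rightarrow> ('f, 's) ipbes \<Rightarrow> ('e list \<Rightarrow> 'f list) \<Rightarrow> bool" where
  "t_simulation \<E> \<F> f \<longleftrightarrow>
     f \<in> traces \<E> \<rightarrow> traces \<F> \<and>
     f [] = [] \<and> (\<forall>\<beta>\<in>traces \<F>. finite {\<alpha> \<in> traces \<E>. f \<alpha> = \<beta>}) \<and>
     (\<forall>\<alpha> e. \<alpha> @ [e] \<in> traces \<E> \<longrightarrow>
        (f (\<alpha> @ [e]) = f \<alpha> \<and> label \<E> e \<sqsubseteq>\<^sub>H skip) \<or>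
        (\<exists>e'\<in>events \<F>. label \<E> e \<sqsubseteq>\<^sub>H label \<F> e' \<and> f (\<alpha> @ [e]) = f \<alpha> @ [e'])) \<and>
     (\<forall>\<alpha> e. \<alpha> @ [e] \<in> max_traces \<E> \<longrightarrow>
        (\<exists>e'\<in>events \<F>. label \<E> e \<sqsubseteq>\<^sub>H label \<F> e' \<and> f (\<alpha> @ [e]) = f \<alpha> @ [e']) \<and>
        weakly_maximal \<F> (f (\<alpha> @ [e])))"

definition sim_le :: "('e, 's::finite) ipbes \<Rightarrow> ('f, 's) ipbes \<Rightarrow> bool" (infix "\<sqsubseteq>\<^sub>s\<^sub>i\<^sub>m" 50) where
  "\<E> \<sqsubseteq>\<^sub>s\<^sub>i\<^sub>m \<F> \<longleftrightarrow> (\<exists>f. t_simulation \<E> \<F> f)"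


subsection \<open>Operations\<close>

text \<open>The operands of a composition are made disjoint by tagging their events
  with \<open>Inl\<close> and \<open>Inr\<close>.\<close>

definition is_zero :: "('e, 's::finite) ipbes \<Rightarrow> bool" where
  "is_zero \<E> \<longleftrightarrow> events \<E> = {} \<and> exits \<E> = {}"

definition par ::
    "('e, 's::finite) ipbes \<Rightarrow> ('f, 's) ipbes \<Rightarrow> ('e + 'f, 's) ipbes" (infixr "\<parallel>\<^sub>E" 60) where
  "\<E> \<parallel>\<^sub>E \<F> = \<lparr>
     events = events \<E> <+> events \<F>,
     bundles = map_prod ((`) Inl) Inl ` bundles \<E> \<union> map_prod ((`) Inr) Inr ` bundles \<F>,
     conflict = map_prod Inl Inl ` conflict \<E> \<union> map_prod Inr Inr ` conflict \<F>,
     label = case_sum (label \<E>) (label \<F>),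
     exits = (`) Inl ` exits \<E> \<union> (`) Inr ` exits \<F>\<rparr>"

text \<open>The case distinction in the exit sets implements the convention \<open>\<E> \<cdot> 0 = \<E>\<close>;
  the convention \<open>0 \<cdot> \<F> = \<F>\<close> is an instance of the general clauses.\<close>

definition seq ::
    "('e, 's::finite) ipbes \<Rightarrow> ('f, 's) ipbes \<Rightarrow> ('e + 'f, 's) ipbes" (infixr "\<cdot>\<^sub>E" 65) where
  "\<E> \<cdot>\<^sub>E \<F> = \<lparr>
     events = events \<E> <+> events \<F>,
     bundles = map_prod ((`) Inl) Inl ` bundles \<E> \<union> map_prod ((`) Inr) Inr ` bundles \<F> \<union>
               {(Inl ` x, Inr e) | x e. x \<in> exits \<E> \<and> e \<in> initial_events \<F>},
     conflict = map_prod Inl Inl ` conflict \<E> \<union> map_prod Inr Inr ` conflict \<F>,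
     label = case_sum (label \<E>) (label \<F>),
     exits = (if is_zero \<F> then (`) Inl ` exits \<E> else (`) Inr ` exits \<F>)\<rparr>"

datatype star_event = Act nat | Done nat

definition star :: "'s::finite prog \<Rightarrow> (star_event, 's) ipbes" where
  "star r = \<lparr>
     events = UNIV,
     bundles = {({Act k}, Act (Suc k)) | k. True} \<union> {({Act k}, Done (Suc k)) | k. True},
     conflict = {(Act k, Done k) | k. True} \<union> {(Done k, Act k) | k. True} \<union>
                {(Done j, Done k) | j k. j \<noteq> k},
     label = case_star_event (\<lambda>_. r) (\<lambda>_. skip),
     exits = {range Done}\<rparr>"


section \<open>Rely-guarantee quintuples\<close>

definition rg_quintuple ::
    "('p, 's::finite) ipbes \<Rightarrow> ('r, 's) ipbes \<Rightarrow> ('e, 's) ipbes \<Rightarrow>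
     ('g, 's) ipbes \<Rightarrow> ('q, 's) ipbes \<Rightarrow> bool" where
  "rg_quintuple P R \<E> G Q \<longleftrightarrow> P \<cdot>\<^sub>E (R \<parallel>\<^sub>E \<E>) \<sqsubseteq> Q \<and> \<E> \<sqsubseteq>\<^sub>s\<^sub>i\<^sub>m G"

end

theory Submission
  imports Defs
begin

text \<open>The guarantee: the two simulations into \<open>g\<^sub>1\<^sup>*\<close> and \<open>g\<^sub>2\<^sup>*\<close> only matter through the number
  of iterations they emit, and these numbers add up along a trace of the parallel composition.

  The correctness part: every step of \<open>E\<^sub>2\<close> is either a step that the rely \<open>r\<^sub>1\<close> allows or an
  invisible one, so \<open>P \<cdot> ((r\<^sub>1 \<inter> r\<^sub>2)\<^sup>* \<parallel> (E\<^sub>1 \<parallel> E\<^sub>2))\<close> is simulated by \<open>P \<cdot> (r\<^sub>1\<^sup>* \<parallel> E\<^sub>1)\<close>. Simulation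
  implies inclusion of the semantics: a scheduler is a flow of probability mass through the
  tree of traces, the simulation pushes this flow forward (fibres are finite, invisible steps
  preserve the state, labels are convex), and normalising the new flow by the mass that
  reaches each trace yields a scheduler of the simulating structure.\<close>

section \<open>Traces\<close>

text \<open>Two obstacles shape the proof. A scheduler sees the trace and the current state, but not
  the initial state, whereas outcomes are compared per initial state. The flow is therefore started
  from a random initial state of full support. The outcomes then agree only on average;
  concentrating the initial distribution near one state turns this into an approximation for that
  state, which the closure in the semantics absorbs. Full support also forces termination from every
  initial state. The other obstacle is \<open>Done\<close>. A simulation into an iteration may emit
  it early, and nothing can follow it, so two such images cannot simply be interleaved into one
  iteration. Counting actions forgets \<open>Done\<close>, which is harmless since its label is
  \<open>skip\<close>. It is put back only at the end of maximal traces: for the guarantee where the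
  last step would otherwise be invisible, for correctness where the rely of the simulating structure
  is still open. There, the mass that has stopped is sent on through \<open>Done\<close>.\<close>

lemma Nil_in_traces [simp]: "[] \<in> traces E"
  by (simp add: traces_def)

text \<open>The one-step form on which all inductions over traces rest. It holds for raw records,
  whose \<open>conflict\<close> may be neither symmetric nor irreflexive; hence both orders of the
  pair and the clause for \<open>(e, e)\<close>.\<close>

lemma traces_snoc:
  "\<alpha> @ [e] \<in> traces E \<longleftrightarrow>
     \<alpha> \<in> traces E \<and> e \<in> events E \<and> e \<notin> set \<alpha> \<and> (e, e) \<notin> conflict E \<and>
     (\<forall>e'\<in>set \<alpha>. (e, e') \<notin> conflict E \<and> (e', e) \<notin> conflict E) \<and>
     (\<forall>x. (x, e) \<in> bundles E \<longrightarrow> x \<inter> set \<alpha> \<noteq> {})"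
proof -
  have *: "(\<forall>j<length (\<alpha> @ [e]). \<forall>x. (x, (\<alpha> @ [e]) ! j) \<in> bundles E \<longrightarrow> (\<exists>i<j. (\<alpha> @ [e]) ! i \<in> x))
    \<longleftrightarrow> (\<forall>j<length \<alpha>. \<forall>x. (x, \<alpha> ! j) \<in> bundles E \<longrightarrow> (\<exists>i<j. \<alpha> ! i \<in> x)) \<and>
      (\<forall>x. (x, e) \<in> bundles E \<longrightarrow> (\<exists>i<length \<alpha>. \<alpha> ! i \<in> x))"
    by (auto simp: less_Suc_eq nth_append all_conj_distrib imp_conjR imp_disjL
        dest: less_trans cong: conj_cong)
  have **: "(\<exists>i<length \<alpha>. \<alpha> ! i \<in> x) \<longleftrightarrow> x \<inter> set \<alpha> \<noteq> {}" for x
    by (auto simp: in_set_conv_nth disjoint_iff)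
  show ?thesis
    unfolding traces_def mem_Collect_eq * ** by auto
qed

lemma traces_appendD: "\<alpha> @ \<beta> \<in> traces E \<Longrightarrow> \<alpha> \<in> traces E"
  by (induction \<beta> rule: rev_induct) (auto simp: traces_snoc simp flip: append_assoc)

text \<open>Traces are closed under prefixes, so a proper extension already yields an extension by
  one event.\<close>

lemma max_traces_iff: "\<alpha> \<in> max_traces E \<longleftrightarrow> \<alpha> \<in> traces E \<and> (\<forall>e. \<alpha> @ [e] \<notin> traces E)"
proof
  assume "\<alpha> \<in> max_traces E"
  then show "\<alpha> \<in> traces E \<and> (\<forall>e. \<alpha> @ [e] \<notin> traces E)"
    by (fastforce simp: max_traces_def prefix_def)
next
  assume *: "\<alpha> \<in> traces E \<and> (\<forall>e. \<alpha> @ [e] \<notin> traces E)"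
  have "\<beta> = \<alpha>" if "\<beta> \<in> traces E" "prefix \<alpha> \<beta>" for \<beta>
  proof -
    from that(2) obtain \<gamma> where \<gamma>: "\<beta> = \<alpha> @ \<gamma>"
      by (auto simp: prefix_def)
    show ?thesis
      using * that(1) traces_appendD[of "\<alpha> @ [hd \<gamma>]" "tl \<gamma>" E]
      unfolding \<gamma> by (cases \<gamma>) auto
  qed
  with * show "\<alpha> \<in> max_traces E"
    by (auto simp: max_traces_def)
qed

section \<open>Projections and interleavings\<close>

primrec lefts :: "('a + 'b) list \<Rightarrow> 'a list" where
  "lefts [] = []"
| "lefts (x # xs) = (case x of Inl a \<Rightarrow> a # lefts xs | Inr b \<Rightarrow> lefts xs)"

primrec rights :: "('a + 'b) list \<Rightarrow> 'b list" where
  "rights [] = []"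
| "rights (x # xs) = (case x of Inl a \<Rightarrow> rights xs | Inr b \<Rightarrow> b # rights xs)"

lemma lefts_append [simp]: "lefts (xs @ ys) = lefts xs @ lefts ys"
  by (induction xs) (auto split: sum.splits)

lemma rights_append [simp]: "rights (xs @ ys) = rights xs @ rights ys"
  by (induction xs) (auto split: sum.splits)

lemma set_lefts [simp]: "set (lefts xs) = Inl -` set xs"
  by (induction xs) (auto split: sum.splits)

lemma set_rights [simp]: "set (rights xs) = Inr -` set xs"
  by (induction xs) (auto split: sum.splits)

lemma length_lefts_rights: "length xs = length (lefts xs) + length (rights xs)"
  by (induction xs) (auto split: sum.splits)

text \<open>Alphabet and length of an interleaving are bounded by those of its projections. This is
  the source of the finite fibres of all simulations below.\<close>

lemma finite_interleavings:
  assumes "finite X" "finite Y"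
  shows "finite {xs. lefts xs \<in> X \<and> rights xs \<in> Y}"
proof -
  define S where "S = Inl ` (\<Union>(set ` X)) \<union> Inr ` (\<Union>(set ` Y))"
  \<comment> \<open>Summing all lengths gives a crude bound that also makes sense for empty
    \<open>X\<close> or \<open>Y\<close>.\<close>
  define n where "n = (\<Sum>x\<in>X. length x) + (\<Sum>y\<in>Y. length y)"
  have "set xs \<subseteq> S \<and> length xs \<le> n" if *: "lefts xs \<in> X" "rights xs \<in> Y" for xs
  proof
    have "x \<in> S" if "x \<in> set xs" for x
    proof (cases x)
      case (Inl a)
      with that have "a \<in> set (lefts xs)" by simp
      with Inl * show ?thesis unfolding S_def by blast
    next
      case (Inr a)
      with that have "a \<in> set (rights xs)" by simp
      with Inr * show ?thesis unfolding S_def by blast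
    qed
    then show "set xs \<subseteq> S" by blast
    show "length xs \<le> n"
      unfolding n_def length_lefts_rights[of xs] using * assms
      by (intro add_mono member_le_sum) auto
  qed
  then have "{xs. lefts xs \<in> X \<and> rights xs \<in> Y} \<subseteq> {xs. set xs \<subseteq> S \<and> length xs \<le> n}"
    by blast
  moreover have "finite S"
    using assms by (auto simp: S_def)
  ultimately show ?thesis
    using finite_lists_length_le finite_subset by blast
qed

lemma image_Int_empty_iff: "f ` y \<inter> S = {} \<longleftrightarrow> y \<inter> f -` S = {}"
  by auto

lemma Inl_bundles_par [simp]:
  "(x, Inl e) \<in> bundles (E \<parallel>\<^sub>E F) \<longleftrightarrow> (\<exists>y. x = Inl ` y \<and> (y, e) \<in> bundles E)"
  and Inr_bundles_par [simp]:
  "(x, Inr e') \<in> bundles (E \<parallel>\<^sub>E F) \<longleftrightarrow> (\<exists>y. x = Inr ` y \<and> (y, e') \<in> bundles F)"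
  by (force simp: par_def)+

text \<open>No bundle and no conflict crosses between the two components.\<close>

lemma traces_par: "\<alpha> \<in> traces (E \<parallel>\<^sub>E F) \<longleftrightarrow> lefts \<alpha> \<in> traces E \<and> rights \<alpha> \<in> traces F"
proof (induction \<alpha> rule: rev_induct)
  case (snoc x \<alpha>)
  show ?case
  proof (cases x)
    case (Inl e)
    have "(\<forall>x. (x, Inl e) \<in> bundles (E \<parallel>\<^sub>E F) \<longrightarrow> x \<inter> set \<alpha> \<noteq> {}) \<longleftrightarrow>
        (\<forall>x. (x, e) \<in> bundles E \<longrightarrow> x \<inter> set (lefts \<alpha>) \<noteq> {})"
      by (auto simp: image_Int_empty_iff)
    moreover have "(\<forall>e'\<in>set \<alpha>. (Inl e, e') \<notin> conflict (E \<parallel>\<^sub>E F) \<and> (e', Inl e) \<notin> conflict (E \<parallel>\<^sub>E F)) \<longleftrightarrow>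
        (\<forall>e'\<in>set (lefts \<alpha>). (e, e') \<notin> conflict E \<and> (e', e) \<notin> conflict E)"
      by (force simp: par_def)
    moreover have "Inl e \<in> events (E \<parallel>\<^sub>E F) \<longleftrightarrow> e \<in> events E"
      "(Inl e, Inl e) \<in> conflict (E \<parallel>\<^sub>E F) \<longleftrightarrow> (e, e) \<in> conflict E"
      by (auto simp: par_def)
    ultimately show ?thesis
      using snoc unfolding Inl traces_snoc by (auto simp: traces_snoc)
  next
    case (Inr e)
    have "(\<forall>x. (x, Inr e) \<in> bundles (E \<parallel>\<^sub>E F) \<longrightarrow> x \<inter> set \<alpha> \<noteq> {}) \<longleftrightarrow>
        (\<forall>x. (x, e) \<in> bundles F \<longrightarrow> x \<inter> set (rights \<alpha>) \<noteq> {})"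
      by (auto simp: image_Int_empty_iff)
    moreover have "(\<forall>e'\<in>set \<alpha>. (Inr e, e') \<notin> conflict (E \<parallel>\<^sub>E F) \<and> (e', Inr e) \<notin> conflict (E \<parallel>\<^sub>E F)) \<longleftrightarrow>
        (\<forall>e'\<in>set (rights \<alpha>). (e, e') \<notin> conflict F \<and> (e', e) \<notin> conflict F)"
      by (force simp: par_def)
    moreover have "Inr e \<in> events (E \<parallel>\<^sub>E F) \<longleftrightarrow> e \<in> events F"
      "(Inr e, Inr e) \<in> conflict (E \<parallel>\<^sub>E F) \<longleftrightarrow> (e, e) \<in> conflict F"
      by (auto simp: par_def)
    ultimately show ?thesis
      using snoc unfolding Inr traces_snoc by (auto simp: traces_snoc)
  qed
qed simp

section \<open>Traces of sequential compositions\<close>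

definition exits_hit :: "('e, 's::finite) ipbes \<Rightarrow> 'e list \<Rightarrow> bool" where
  "exits_hit E \<alpha> \<longleftrightarrow> (\<forall>x\<in>exits E. x \<inter> set \<alpha> \<noteq> {})"

lemma Inl_bundles_seq [simp]:
  "(x, Inl e) \<in> bundles (E \<cdot>\<^sub>E F) \<longleftrightarrow> (\<exists>y. x = Inl ` y \<and> (y, e) \<in> bundles E)"
  and Inr_bundles_seq [simp]:
  "(x, Inr e') \<in> bundles (E \<cdot>\<^sub>E F) \<longleftrightarrow> (\<exists>y. x = Inr ` y \<and> (y, e') \<in> bundles F) \<or>
     (\<exists>y. x = Inl ` y \<and> y \<in> exits E \<and> e' \<in> initial_events F)"
  by (force simp: seq_def)+

lemma traces_seq_snoc_Inl:
  "\<alpha> @ [Inl e] \<in> traces (E \<cdot>\<^sub>E F) \<longleftrightarrow>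
     \<alpha> \<in> traces (E \<cdot>\<^sub>E F) \<and> e \<in> events E \<and> e \<notin> set (lefts \<alpha>) \<and> (e, e) \<notin> conflict E \<and>
     (\<forall>e'\<in>set (lefts \<alpha>). (e, e') \<notin> conflict E \<and> (e', e) \<notin> conflict E) \<and>
     (\<forall>x. (x, e) \<in> bundles E \<longrightarrow> x \<inter> set (lefts \<alpha>) \<noteq> {})"
proof -
  have "(\<forall>x. (x, Inl e) \<in> bundles (E \<cdot>\<^sub>E F) \<longrightarrow> x \<inter> set \<alpha> \<noteq> {}) \<longleftrightarrow>
        (\<forall>x. (x, e) \<in> bundles E \<longrightarrow> x \<inter> set (lefts \<alpha>) \<noteq> {})"
    by (auto simp: image_Int_empty_iff)
  moreover have "(\<forall>e'\<in>set \<alpha>. (Inl e, e') \<notin> conflict (E \<cdot>\<^sub>E F) \<and> (e', Inl e) \<notin> conflict (E \<cdot>\<^sub>E F)) \<longleftrightarrow>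
        (\<forall>e'\<in>set (lefts \<alpha>). (e, e') \<notin> conflict E \<and> (e', e) \<notin> conflict E)"
    by (force simp: seq_def)
  moreover have "Inl e \<in> events (E \<cdot>\<^sub>E F) \<longleftrightarrow> e \<in> events E"
    "(Inl e, Inl e) \<in> conflict (E \<cdot>\<^sub>E F) \<longleftrightarrow> (e, e) \<in> conflict E"
    by (auto simp: seq_def)
  ultimately show ?thesis
    unfolding traces_snoc by auto
qed

lemma traces_seq_snoc_Inr:
  "\<alpha> @ [Inr e] \<in> traces (E \<cdot>\<^sub>E F) \<longleftrightarrow>
     \<alpha> \<in> traces (E \<cdot>\<^sub>E F) \<and> e \<in> events F \<and> e \<notin> set (rights \<alpha>) \<and> (e, e) \<notin> conflict F \<and>
     (\<forall>e'\<in>set (rights \<alpha>). (e, e') \<notin> conflict F \<and> (e', e) \<notin> conflict F) \<and>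
     (\<forall>x. (x, e) \<in> bundles F \<longrightarrow> x \<inter> set (rights \<alpha>) \<noteq> {}) \<and>
     (e \<in> initial_events F \<longrightarrow> exits_hit E (lefts \<alpha>))"
proof -
  have "(\<forall>x. (x, Inr e) \<in> bundles (E \<cdot>\<^sub>E F) \<longrightarrow> x \<inter> set \<alpha> \<noteq> {}) \<longleftrightarrow>
        (\<forall>x. (x, e) \<in> bundles F \<longrightarrow> x \<inter> set (rights \<alpha>) \<noteq> {}) \<and>
        (e \<in> initial_events F \<longrightarrow> exits_hit E (lefts \<alpha>))"
    (is "?l \<longleftrightarrow> _")
  proof -
    have "?l \<longleftrightarrow> (\<forall>y. (y, e) \<in> bundles F \<longrightarrow> Inr ` y \<inter> set \<alpha> \<noteq> {}) \<and>
        (\<forall>y. y \<in> exits E \<and> e \<in> initial_events F \<longrightarrow> Inl ` y \<inter> set \<alpha> \<noteq> {})"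
      unfolding Inr_bundles_seq by metis
    then show ?thesis
      by (auto simp: image_Int_empty_iff exits_hit_def)
  qed
  moreover have "(\<forall>e'\<in>set \<alpha>. (Inr e, e') \<notin> conflict (E \<cdot>\<^sub>E F) \<and> (e', Inr e) \<notin> conflict (E \<cdot>\<^sub>E F)) \<longleftrightarrow>
        (\<forall>e'\<in>set (rights \<alpha>). (e, e') \<notin> conflict F \<and> (e', e) \<notin> conflict F)"
    by (force simp: seq_def)
  moreover have "Inr e \<in> events (E \<cdot>\<^sub>E F) \<longleftrightarrow> e \<in> events F"
    "(Inr e, Inr e) \<in> conflict (E \<cdot>\<^sub>E F) \<longleftrightarrow> (e, e) \<in> conflict F"
    by (auto simp: seq_def)
  ultimately show ?thesis
    unfolding traces_snoc by auto
qed

text \<open>The first event of the second operand to occur is initial there, so all exit sets of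
  the first operand have been hit by then.\<close>

lemma traces_seqD:
  assumes "\<alpha> \<in> traces (E \<cdot>\<^sub>E F)"
  shows "lefts \<alpha> \<in> traces E \<and> rights \<alpha> \<in> traces F \<and> (rights \<alpha> \<noteq> [] \<longrightarrow> exits_hit E (lefts \<alpha>))"
  using assms
proof (induction \<alpha> rule: rev_induct)
  case (snoc x \<alpha>)
  show ?case
  proof (cases x)
    case (Inl e)
    show ?thesis
      using snoc.prems snoc.IH unfolding Inl traces_seq_snoc_Inl
      by (auto simp: traces_snoc exits_hit_def)
  next
    case (Inr e)
    have "exits_hit E (lefts \<alpha>)"
    proof (cases "e \<in> initial_events F")
      case False
      with snoc.prems show ?thesis
        using snoc.IH unfolding Inr traces_seq_snoc_Inr initial_events_def
        by (cases "rights \<alpha> = []") auto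
    qed (use snoc.prems in \<open>auto simp: Inr traces_seq_snoc_Inr\<close>)
    then show ?thesis
      using snoc.prems snoc.IH unfolding Inr traces_seq_snoc_Inr by (auto simp: traces_snoc)
  qed
qed simp

text \<open>Sequencing adds bundles into the second operand only, so the first one may go on after
  the second has started.\<close>

lemma traces_seq_Inl:
  "\<alpha> @ [Inl e] \<in> traces (E \<cdot>\<^sub>E F) \<longleftrightarrow> \<alpha> \<in> traces (E \<cdot>\<^sub>E F) \<and> lefts \<alpha> @ [e] \<in> traces E"
  using traces_seqD[of \<alpha> E F] unfolding traces_seq_snoc_Inl traces_snoc[of "lefts \<alpha>"] by blast

text \<open>By \<open>traces_seqD\<close> the condition on the exits may be demanded of every event
  of \<open>F\<close>, not only of the initial ones. This makes it independent of the event.\<close>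

lemma traces_seq_Inr:
  "\<alpha> @ [Inr e] \<in> traces (E \<cdot>\<^sub>E F) \<longleftrightarrow>
     \<alpha> \<in> traces (E \<cdot>\<^sub>E F) \<and> rights \<alpha> @ [e] \<in> traces F \<and> exits_hit E (lefts \<alpha>)"
  (is "?l \<longleftrightarrow> ?r")
proof
  assume ?l
  then have "exits_hit E (lefts \<alpha>)"
    using traces_seqD[of "\<alpha> @ [Inr e]" E F] by simp
  with \<open>?l\<close> show ?r
    using traces_seqD[of \<alpha> E F] unfolding traces_seq_snoc_Inr by (auto simp: traces_snoc)
next
  assume ?r
  then show ?l
    unfolding traces_seq_snoc_Inr traces_snoc[of "rights \<alpha>"] by blast
qed

section \<open>Iteration\<close>

primrec is_Act :: "star_event \<Rightarrow> bool" where
  "is_Act (Act k) = True"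
| "is_Act (Done k) = False"

definition num_acts :: "star_event list \<Rightarrow> nat" where
  "num_acts \<alpha> = length (filter is_Act \<alpha>)"

lemma num_acts_simps [simp]:
  "num_acts [] = 0" "num_acts (\<alpha> @ [Act k]) = Suc (num_acts \<alpha>)" "num_acts (\<alpha> @ [Done k]) = num_acts \<alpha>"
  "num_acts (map Act ks) = length ks"
  by (auto simp: num_acts_def comp_def)

lemma star_simps [simp]:
  "events (star r) = UNIV" "label (star r) (Act k) = r" "label (star r) (Done k) = skip"
  "(x, Act k) \<in> bundles (star r) \<longleftrightarrow> k > 0 \<and> x = {Act (k - 1)}"
  "(x, Done k) \<in> bundles (star r) \<longleftrightarrow> k > 0 \<and> x = {Act (k - 1)}"
  "(Act j, Act k) \<notin> conflict (star r)"
  "(Act j, Done k) \<in> conflict (star r) \<longleftrightarrow> j = k"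
  "(Done j, Act k) \<in> conflict (star r) \<longleftrightarrow> j = k"
  "(Done j, Done k) \<in> conflict (star r) \<longleftrightarrow> j \<noteq> k"
  by (auto simp: star_def intro: gr0_implies_Suc)

abbreviation acts :: "nat \<Rightarrow> star_event list" where
  "acts n \<equiv> map Act [0..<n]"

lemma acts_in_star_traces: "acts n \<in> traces (star r)"
  by (induction n) (auto simp: traces_snoc)

lemma acts_snoc_in_star_traces: "acts n @ [x] \<in> traces (star r) \<longleftrightarrow> x = Act n \<or> x = Done n"
proof (cases x)
  case (Act k)
  then show ?thesis
    by (cases "k < n") (auto simp: traces_snoc acts_in_star_traces)
next
  case (Done k)
  then show ?thesis
    by (cases "k < n") (auto simp: traces_snoc acts_in_star_traces)
qed

lemma acts_Done_in_star_max_traces: "acts n @ [Done n] \<in> max_traces (star r)"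
proof -
  have "(acts n @ [Done n]) @ [x] \<notin> traces (star r)" for x
  proof (cases x)
    case (Act k)
    then show ?thesis
      by (cases "k < n") (auto simp only: traces_snoc, auto)
  qed (simp only: traces_snoc, auto)
  then show ?thesis
    unfolding max_traces_iff acts_snoc_in_star_traces by simp
qed

text \<open>\<open>Act n\<close> and \<open>Done n\<close> compete for position \<open>n\<close>,
  and nothing follows \<open>Done n\<close>. Up to this last event a trace is thus determined by its
  number of actions, which is why a simulation by an iteration reduces to a count.\<close>

lemma star_traces:
  "\<alpha> \<in> traces (star r) \<longleftrightarrow> \<alpha> = acts (num_acts \<alpha>) \<or> \<alpha> = acts (num_acts \<alpha>) @ [Done (num_acts \<alpha>)]"
proof
  show "\<alpha> = acts (num_acts \<alpha>) \<or> \<alpha> = acts (num_acts \<alpha>) @ [Done (num_acts \<alpha>)]"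
    if "\<alpha> \<in> traces (star r)" using that
  proof (induction \<alpha> rule: rev_induct)
    case (snoc x \<alpha>)
    let ?n = "num_acts \<alpha>"
    have "\<alpha> \<noteq> acts ?n @ [Done ?n]"
      using acts_Done_in_star_max_traces[of ?n r] snoc.prems unfolding max_traces_iff by metis
    moreover have "\<alpha> \<in> traces (star r)"
      using snoc.prems traces_appendD by blast
    ultimately have \<alpha>: "\<alpha> = acts ?n"
      using snoc.IH by blast
    then have "x = Act ?n \<or> x = Done ?n"
      using snoc.prems by (metis acts_snoc_in_star_traces)
    then show ?case
      using \<alpha> by auto
  qed simp
next
  show "\<alpha> \<in> traces (star r)"
    if "\<alpha> = acts (num_acts \<alpha>) \<or> \<alpha> = acts (num_acts \<alpha>) @ [Done (num_acts \<alpha>)]"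
    using that acts_in_star_traces acts_snoc_in_star_traces by metis
qed

text \<open>A trace without \<open>Done\<close> is completed by one \<open>Done\<close>, a skip. So
  the maximality demand of a t-simulation into an iteration holds automatically.\<close>

lemma weakly_maximal_star: "\<alpha> \<in> traces (star r) \<Longrightarrow> weakly_maximal (star r) \<alpha>"
proof -
  assume \<alpha>: "\<alpha> \<in> traces (star r)"
  let ?n = "num_acts \<alpha>"
  from \<alpha> consider "\<alpha> = acts ?n" | "\<alpha> = acts ?n @ [Done ?n]"
    using star_traces by blast
  then show ?thesis
  proof cases
    case 1
    then have "\<alpha> @ [Done ?n] \<in> max_traces (star r)"
      using acts_Done_in_star_max_traces by metis
    then show ?thesis
      unfolding weakly_maximal_def using \<alpha> by (auto simp: H_le_def intro!: exI[of _ "[Done ?n]"])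
  next
    case 2
    then have "\<alpha> \<in> max_traces (star r)"
      using acts_Done_in_star_max_traces by metis
    with \<alpha> show ?thesis
      by (auto simp: weakly_maximal_def)
  qed
qed

section \<open>Simulation by an iteration\<close>

text \<open>What remains of a t-simulation by \<open>star g\<close> when only the number of \<open>Act\<close> events in
  the image of a trace is recorded.\<close>

definition step_count :: "('e, 's::finite) ipbes \<Rightarrow> 's prog \<Rightarrow> ('e list \<Rightarrow> nat) \<Rightarrow> bool" where
  "step_count E g c \<longleftrightarrow> c [] = 0 \<and> (\<forall>n. finite {\<alpha> \<in> traces E. c \<alpha> = n}) \<and>
     (\<forall>\<alpha> e. \<alpha> @ [e] \<in> traces E \<longrightarrow>
        c (\<alpha> @ [e]) = c \<alpha> \<and> label E e \<sqsubseteq>\<^sub>H skip \<or> c (\<alpha> @ [e]) = Suc (c \<alpha>) \<and> label E e \<sqsubseteq>\<^sub>H g)"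

lemma step_count_mono: "step_count E g c \<Longrightarrow> g \<sqsubseteq>\<^sub>H g' \<Longrightarrow> step_count E g' c"
  unfolding step_count_def H_le_def by blast

text \<open>A \<open>Done\<close> in the image is reread as an invisible step. This merges the
  fibres of \<open>acts n\<close> and \<open>acts n @ [Done n]\<close>, so fibres stay
  finite.\<close>

lemma step_count_if_simulation:
  assumes "t_simulation E (star g) f"
  shows "step_count E g (\<lambda>\<alpha>. num_acts (f \<alpha>))"
proof -
  have f: "f \<alpha> \<in> traces (star g)" if "\<alpha> \<in> traces E" for \<alpha>
    using assms that by (auto simp: t_simulation_def)
  have fin: "finite {\<alpha> \<in> traces E. f \<alpha> = \<beta>}" if "\<beta> \<in> traces (star g)" for \<beta>
    using assms that by (auto simp: t_simulation_def)
  have "finite {\<alpha> \<in> traces E. num_acts (f \<alpha>) = n}" for n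
  proof (rule finite_subset)
    show "{\<alpha> \<in> traces E. num_acts (f \<alpha>) = n} \<subseteq>
        {\<alpha> \<in> traces E. f \<alpha> = acts n} \<union> {\<alpha> \<in> traces E. f \<alpha> = acts n @ [Done n]}"
      using f star_traces by blast
    show "finite \<dots>"
      using fin acts_in_star_traces[of n g] acts_snoc_in_star_traces[of n _ g] by auto
  qed
  moreover have "num_acts (f (\<alpha> @ [e])) = num_acts (f \<alpha>) \<and> label E e \<sqsubseteq>\<^sub>H skip \<or>
      num_acts (f (\<alpha> @ [e])) = Suc (num_acts (f \<alpha>)) \<and> label E e \<sqsubseteq>\<^sub>H g" if e: "\<alpha> @ [e] \<in> traces E" for \<alpha> e
  proof -
    from assms e consider "f (\<alpha> @ [e]) = f \<alpha>" "label E e \<sqsubseteq>\<^sub>H skip"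
      | e' where "label E e \<sqsubseteq>\<^sub>H label (star g) e'" "f (\<alpha> @ [e]) = f \<alpha> @ [e']"
      unfolding t_simulation_def by blast
    then show ?thesis
    proof cases
      case (2 e')
      then show ?thesis by (cases e') auto
    qed simp
  qed
  ultimately show ?thesis
    using assms by (auto simp: step_count_def t_simulation_def)
qed

lemma step_count_star: "step_count (star r) r num_acts"
proof -
  have "finite {\<alpha> \<in> traces (star r). num_acts \<alpha> = n}" for n
    by (rule finite_subset[of _ "{acts n, acts n @ [Done n]}"]) (use star_traces in auto)
  moreover have "num_acts (\<alpha> @ [e]) = num_acts \<alpha> \<and> label (star r) e \<sqsubseteq>\<^sub>H skip \<or>
      num_acts (\<alpha> @ [e]) = Suc (num_acts \<alpha>) \<and> label (star r) e \<sqsubseteq>\<^sub>H r" for \<alpha> e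
    by (cases e) (auto simp: H_le_def)
  ultimately show ?thesis
    by (auto simp: step_count_def)
qed

lemma step_count_finite_le:
  assumes "step_count E g c"
  shows "finite {\<alpha> \<in> traces E. c \<alpha> \<le> n}"
proof -
  have "{\<alpha> \<in> traces E. c \<alpha> \<le> n} = (\<Union>k\<le>n. {\<alpha> \<in> traces E. c \<alpha> = k})"
    by auto
  with assms show ?thesis
    by (auto simp: step_count_def)
qed

text \<open>Each event advances one projection and hence one summand by at most one. Both summands
  are at most \<open>n\<close> on the fibre of \<open>n\<close>, which leaves finitely many
  interleavings.\<close>

lemma step_count_par:
  assumes "step_count E g c" "step_count F g d"
  shows "step_count (E \<parallel>\<^sub>E F) g (\<lambda>\<gamma>. c (lefts \<gamma>) + d (rights \<gamma>))"
proof -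
  have "finite {\<gamma> \<in> traces (E \<parallel>\<^sub>E F). c (lefts \<gamma>) + d (rights \<gamma>) = n}" for n
    by (rule finite_subset[OF _ finite_interleavings[OF
        step_count_finite_le[OF assms(1), of n] step_count_finite_le[OF assms(2), of n]]])
      (auto simp: traces_par)
  moreover have "(c (lefts (\<gamma> @ [x])) + d (rights (\<gamma> @ [x])) = c (lefts \<gamma>) + d (rights \<gamma>) \<and>
          label (E \<parallel>\<^sub>E F) x \<sqsubseteq>\<^sub>H skip) \<or>
        (c (lefts (\<gamma> @ [x])) + d (rights (\<gamma> @ [x])) = Suc (c (lefts \<gamma>) + d (rights \<gamma>)) \<and>
          label (E \<parallel>\<^sub>E F) x \<sqsubseteq>\<^sub>H g)"
    if "\<gamma> @ [x] \<in> traces (E \<parallel>\<^sub>E F)" for \<gamma> x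
  proof (cases x)
    case (Inl e)
    with that have "lefts \<gamma> @ [e] \<in> traces E"
      by (simp add: traces_par)
    with assms(1) show ?thesis
      unfolding step_count_def by (auto simp: Inl par_def)
  next
    case (Inr e)
    with that have "rights \<gamma> @ [e] \<in> traces F"
      by (simp add: traces_par)
    with assms(2) show ?thesis
      unfolding step_count_def by (auto simp: Inr par_def)
  qed
  ultimately show ?thesis
    using assms by (auto simp: step_count_def)
qed

lemma sim_le_star_if_step_count:
  assumes "step_count E g c"
  shows "E \<sqsubseteq>\<^sub>s\<^sub>i\<^sub>m star g"
proof -
  \<comment> \<open>The last event of a maximal trace must be visible in the image, so
    \<open>Done\<close> is emitted exactly where that event left the count unchanged. The empty
    trace is excluded because \<open>f [] = []\<close> must hold even if it is maximal.\<close>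
  define f where "f \<alpha> = acts (c \<alpha>) @
    (if \<alpha> \<in> max_traces E \<and> \<alpha> \<noteq> [] \<and> c \<alpha> = c (butlast \<alpha>) then [Done (c \<alpha>)] else [])" for \<alpha>
  have [simp]: "num_acts (f \<alpha>) = c \<alpha>" for \<alpha>
    by (auto simp: f_def)
  have f: "f \<alpha> \<in> traces (star g)" for \<alpha>
    by (auto simp: f_def acts_in_star_traces acts_snoc_in_star_traces)
  have nonmax: "f \<alpha> = acts (c \<alpha>)" if "\<alpha> @ [e] \<in> traces E" for \<alpha> e
    using that by (auto simp: f_def max_traces_iff)
  have step: "c (\<alpha> @ [e]) = c \<alpha> \<and> label E e \<sqsubseteq>\<^sub>H skip \<or> c (\<alpha> @ [e]) = Suc (c \<alpha>) \<and> label E e \<sqsubseteq>\<^sub>H g"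
    if "\<alpha> @ [e] \<in> traces E" for \<alpha> e
    using assms that by (auto simp: step_count_def)
  have max: "\<exists>e'. label E e \<sqsubseteq>\<^sub>H label (star g) e' \<and> f (\<alpha> @ [e]) = f \<alpha> @ [e']"
    if "\<alpha> @ [e] \<in> max_traces E" for \<alpha> e
  proof -
    have e: "\<alpha> @ [e] \<in> traces E"
      using that by (simp add: max_traces_iff)
    from step[OF e] show ?thesis
    proof
      assume "c (\<alpha> @ [e]) = c \<alpha> \<and> label E e \<sqsubseteq>\<^sub>H skip"
      then show ?thesis
        unfolding nonmax[OF e] using that by (intro exI[of _ "Done (c \<alpha>)"]) (simp add: f_def)
    next
      assume "c (\<alpha> @ [e]) = Suc (c \<alpha>) \<and> label E e \<sqsubseteq>\<^sub>H g"
      then show ?thesis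
        unfolding nonmax[OF e] by (intro exI[of _ "Act (c \<alpha>)"]) (simp add: f_def)
    qed
  qed
  have "f (\<alpha> @ [e]) = f \<alpha> \<and> label E e \<sqsubseteq>\<^sub>H skip \<or>
      (\<exists>e'. label E e \<sqsubseteq>\<^sub>H label (star g) e' \<and> f (\<alpha> @ [e]) = f \<alpha> @ [e'])"
    if e: "\<alpha> @ [e] \<in> traces E" for \<alpha> e
  proof (cases "\<alpha> @ [e] \<in> max_traces E")
    case True
    from max[OF this] show ?thesis by blast
  next
    case False
    from step[OF e] show ?thesis
    proof
      assume "c (\<alpha> @ [e]) = c \<alpha> \<and> label E e \<sqsubseteq>\<^sub>H skip"
      then show ?thesis
        unfolding nonmax[OF e] using False by (simp add: f_def)
    next
      assume "c (\<alpha> @ [e]) = Suc (c \<alpha>) \<and> label E e \<sqsubseteq>\<^sub>H g"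
      then show ?thesis
        unfolding nonmax[OF e] by (intro disjI2 exI[of _ "Act (c \<alpha>)"]) (simp add: f_def)
    qed
  qed
  moreover have "finite {\<alpha> \<in> traces E. f \<alpha> = \<beta>}" for \<beta>
  proof (rule finite_subset)
    show "{\<alpha> \<in> traces E. f \<alpha> = \<beta>} \<subseteq> {\<alpha> \<in> traces E. c \<alpha> = num_acts \<beta>}"
      by auto
    show "finite \<dots>"
      using assms by (auto simp: step_count_def)
  qed
  moreover have "f [] = []"
    using assms by (simp add: f_def step_count_def)
  ultimately have "t_simulation E (star g) f"
    using f max weakly_maximal_star[OF f] by (auto simp: t_simulation_def)
  then show ?thesis
    by (auto simp: sim_le_def)
qed

text \<open>Take p = 0 and p = 1; the other operand is non-empty and supplies the distribution of
  weight zero.\<close>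

lemma H_choice_upper:
  assumes "g \<in> H1" "g' \<in> H1"
  shows "g \<sqsubseteq>\<^sub>H g +\<^sub>H g'" "g' \<sqsubseteq>\<^sub>H g +\<^sub>H g'"
proof -
  have "\<exists>\<mu>. \<mu> \<in> g s" "\<exists>\<mu>. \<mu> \<in> g' s" for s
    using assms by (auto simp: H1_def)
  then show "g \<sqsubseteq>\<^sub>H g +\<^sub>H g'" "g' \<sqsubseteq>\<^sub>H g +\<^sub>H g'"
    unfolding H_le_def H_choice_def
    by (fastforce intro: exI[of _ 0] exI[of _ 1])+
qed

section \<open>Schedulers as flows\<close>

lemma has_sum_vec_iff:
  fixes f :: "'a \<Rightarrow> real ^ 'n"
  shows "(f has_sum x) A \<longleftrightarrow> (\<forall>i. ((\<lambda>a. f a $ i) has_sum (x $ i)) A)"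
proof
  assume "(f has_sum x) A"
  then show "\<forall>i. ((\<lambda>a. f a $ i) has_sum (x $ i)) A"
    by (auto intro: has_sum_bounded_linear[OF bounded_linear_vec_nth])
next
  assume "\<forall>i. ((\<lambda>a. f a $ i) has_sum (x $ i)) A"
  then show "(f has_sum x) A"
    unfolding has_sum_def by (intro vec_tendstoI) (simp add: sum_component)
qed

lemma has_sum_group:
  fixes f :: "'a \<Rightarrow> 'c :: {topological_comm_monoid_add, t3_space}"
  assumes "(f has_sum a) S" "\<And>x. x \<in> S \<Longrightarrow> k x \<in> T"
    and "\<And>t. t \<in> T \<Longrightarrow> (f has_sum b t) {x \<in> S. k x = t}"
  shows "(b has_sum a) T"
proof -
  have "bij_betw snd (SIGMA t:T. {x \<in> S. k x = t}) S"
    using assms(2) by (intro bij_betwI[where g = "\<lambda>x. (k x, x)"]) auto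
  from has_sum_reindex_bij_betw[OF this, of f a] assms(1)
  have "((\<lambda>z. f (snd z)) has_sum a) (SIGMA t:T. {x \<in> S. k x = t})"
    by simp
  then show ?thesis
    by (rule has_sum_SigmaD) (use assms(3) in simp)
qed

text \<open>Adding the finitely supported function that is \<open>- f\<close> on \<open>T\<close>
  cancels these terms, so no summability on subsets has to be known.\<close>

lemma has_sum_Diff_finite:
  fixes f :: "'a \<Rightarrow> 'c :: topological_ab_group_add"
  assumes "(f has_sum a) S" "finite T" "T \<subseteq> S"
  shows "(f has_sum (a - sum f T)) (S - T)"
proof -
  have "((\<lambda>x. if x \<in> T then - f x else 0) has_sum (\<Sum>x\<in>T. - f x)) S"
    using assms(2,3) by (intro has_sum_finite_neutralI[of T]) auto
  from has_sum_add[OF assms(1) this]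
  have "((\<lambda>x. f x + (if x \<in> T then - f x else 0)) has_sum (a - sum f T)) S"
    by (simp add: sum_negf)
  then show ?thesis
    by (subst has_sum_cong_neutral[where g = "\<lambda>x. f x + (if x \<in> T then - f x else 0)" and T = S]) auto
qed

text \<open>The first disjunct matters for empty \<open>L\<close>: a disabled event carries no weight.\<close>

definition scaled :: "(real ^ 's) set \<Rightarrow> real \<Rightarrow> real ^ 's \<Rightarrow> bool" where
  "scaled L c v \<longleftrightarrow> c = 0 \<and> v = 0 \<or> 0 \<le> c \<and> (\<exists>\<mu>\<in>L. v = c *\<^sub>R \<mu>)"

lemma scaled_0 [simp]: "scaled L 0 0"
  by (simp add: scaled_def)

lemma scaled_nonneg: "scaled L c v \<Longrightarrow> 0 \<le> c"
  by (auto simp: scaled_def)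

lemma scaled_zero: "scaled L 0 v \<Longrightarrow> v = 0"
  by (auto simp: scaled_def)

lemma scaled_mono: "scaled L c v \<Longrightarrow> L \<subseteq> L' \<Longrightarrow> scaled L' c v"
  by (auto simp: scaled_def)

lemma scaled_scaleR: "scaled L c v \<Longrightarrow> 0 \<le> k \<Longrightarrow> scaled L (k * c) (k *\<^sub>R v)"
  by (auto simp: scaled_def)

text \<open>The sum is \<open>c + d\<close> times the convex combination with weights proportional
  to \<open>c\<close> and \<open>d\<close>. A zero weight is split off because its vector need not
  come from a member of \<open>L\<close>.\<close>

lemma scaled_add:
  assumes "convex L" "scaled L c v" "scaled L d w"
  shows "scaled L (c + d) (v + w)"
proof (cases "c = 0 \<or> d = 0")
  case True
  with assms show ?thesis
    using scaled_zero[of L v] scaled_zero[of L w] by auto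
next
  case False
  with assms(2,3) obtain \<mu> \<nu> where *: "\<mu> \<in> L" "\<nu> \<in> L" "v = c *\<^sub>R \<mu>" "w = d *\<^sub>R \<nu>" "0 < c" "0 < d"
    by (auto simp: scaled_def)
  then have "(c / (c + d)) *\<^sub>R \<mu> + (d / (c + d)) *\<^sub>R \<nu> \<in> L"
    by (intro convexD[OF assms(1)]) (auto simp flip: add_divide_distrib)
  moreover have "v + w = (c + d) *\<^sub>R ((c / (c + d)) *\<^sub>R \<mu> + (d / (c + d)) *\<^sub>R \<nu>)"
    using * by (simp add: scaleR_add_right)
  ultimately show ?thesis
    using * by (auto simp: scaled_def)
qed

lemma scaled_sum:
  assumes "convex L" "\<And>i. i \<in> I \<Longrightarrow> scaled L (c i) (v i)"
  shows "scaled L (\<Sum>i\<in>I. c i) (\<Sum>i\<in>I. v i)"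
  using assms(2) by (induction I rule: infinite_finite_induct) (auto intro: scaled_add[OF assms(1)])

lemma scaled_mass:
  assumes "L \<subseteq> dists" "scaled L c v"
  shows "(\<Sum>u\<in>UNIV. v $ u) = c" "0 \<le> v $ u"
  using assms by (auto simp: scaled_def dists_def simp flip: sum_distrib_left)

text \<open>Chooses the weights of all traces at once; \<open>scaled\<close> covers enabled and
  disabled events uniformly.\<close>

lemma scheduler_weights:
  assumes "is_scheduler E \<sigma>"
  obtains w where
    "\<And>\<alpha> e t. \<alpha> @ [e] \<in> traces E \<Longrightarrow> scaled (label E e t) (w \<alpha> e t) (the (\<sigma> \<alpha> (e, t)))"
    "\<And>\<alpha> e t. \<alpha> @ [e] \<in> traces E \<Longrightarrow> ((\<lambda>e. w \<alpha> e t) has_sum 1) {e. \<alpha> @ [e] \<in> traces E}"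
proof -
  have "\<exists>w. (\<forall>e t. \<alpha> @ [e] \<in> traces E \<longrightarrow> scaled (label E e t) (w e t) (the (\<sigma> \<alpha> (e, t)))) \<and>
      (\<forall>e t. \<alpha> @ [e] \<in> traces E \<longrightarrow> ((\<lambda>e. w e t) has_sum 1) {e. \<alpha> @ [e] \<in> traces E})" for \<alpha>
  proof (cases "\<exists>e. \<alpha> @ [e] \<in> traces E")
    case True
    then have "\<alpha> \<in> traces E"
      using traces_appendD by blast
    with assms have dom: "dom (\<sigma> \<alpha>) = {(e, s). \<alpha> @ [e] \<in> traces E}"
      and "\<exists>w :: 'a \<times> 'b \<Rightarrow> real. range w \<subseteq> {0..1} \<and>
       (\<forall>(e, s)\<in>dom (\<sigma> \<alpha>).
          (label E e s \<noteq> {} \<longrightarrow> (\<exists>\<mu>\<in>label E e s. \<sigma> \<alpha> (e, s) = Some (w (e, s) *\<^sub>R \<mu>))) \<and>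
          (label E e s = {} \<longrightarrow> w (e, s) = 0 \<and> \<sigma> \<alpha> (e, s) = Some 0)) \<and>
       (dom (\<sigma> \<alpha>) \<noteq> {} \<longrightarrow>
          (\<forall>s. ((\<lambda>e. w (e, s)) has_sum 1) {e. \<alpha> @ [e] \<in> traces E}))"
      unfolding is_scheduler_def by blast+
    then obtain w :: "'a \<times> 'b \<Rightarrow> real" where w: "range w \<subseteq> {0..1}"
        "\<And>e s. (e, s) \<in> dom (\<sigma> \<alpha>) \<Longrightarrow>
          (label E e s \<noteq> {} \<longrightarrow> (\<exists>\<mu>\<in>label E e s. \<sigma> \<alpha> (e, s) = Some (w (e, s) *\<^sub>R \<mu>))) \<and>
          (label E e s = {} \<longrightarrow> w (e, s) = 0 \<and> \<sigma> \<alpha> (e, s) = Some 0)"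
        "dom (\<sigma> \<alpha>) \<noteq> {} \<Longrightarrow> (\<forall>s. ((\<lambda>e. w (e, s)) has_sum 1) {e. \<alpha> @ [e] \<in> traces E})"
      by blast
    have "0 \<le> w z" for z
      using w(1) by (auto simp: subset_iff)
    then have "scaled (label E e t) (w (e, t)) (the (\<sigma> \<alpha> (e, t)))" if "\<alpha> @ [e] \<in> traces E" for e t
      using w(2)[of e t] that unfolding dom scaled_def by (cases "label E e t = {}") auto
    moreover have "dom (\<sigma> \<alpha>) \<noteq> {}"
      using True by (auto simp: dom)
    ultimately show ?thesis
      using w(3) by (intro exI[of _ "\<lambda>e t. w (e, t)"]) blast
  qed blast
  then show ?thesis
    using that by metis
qed

lemma scheduler_nonneg:
  assumes "is_scheduler E \<sigma>" "\<alpha> @ [e] \<in> traces E"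
  shows "0 \<le> the (\<sigma> \<alpha> (e, t)) $ u"
proof -
  have "\<alpha> \<in> traces E"
    using assms(2) traces_appendD by blast
  with assms(1) have "dom (\<sigma> \<alpha>) = {(e, s). \<alpha> @ [e] \<in> traces E}" "ran (\<sigma> \<alpha>) \<subseteq> subdists"
    unfolding is_scheduler_def by blast+
  with assms(2) obtain \<mu> where "\<sigma> \<alpha> (e, t) = Some \<mu>" "\<mu> \<in> subdists"
    by (smt (verit, best) case_prodI domD mem_Collect_eq ranI subset_iff)
  then show ?thesis
    by (simp add: subdists_def)
qed

lemma phi_nonneg:
  assumes "is_scheduler E \<sigma>" "\<alpha> \<in> traces E"
  shows "0 \<le> phi \<sigma> s \<alpha> $ u"
  using assms(2)
proof (induction \<alpha> arbitrary: u rule: rev_induct)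
  case Nil
  then show ?case
    by (simp add: point_def axis_def)
next
  case (snoc e \<alpha>)
  then have "0 \<le> phi \<sigma> s \<alpha> $ t" for t
    using traces_appendD by blast
  with scheduler_nonneg[OF assms(1) snoc.prems] show ?case
    by (auto simp: phi_snoc intro!: sum_nonneg)
qed

lemma point_in_dists: "point s \<in> dists"
  by (simp add: dists_def point_def axis_def)

lemma H1_bar_dists: "b \<in> H1_bar \<Longrightarrow> b s \<subseteq> dists"
  using point_in_dists by (fastforce simp: H1_bar_def H1_def tests_def)

lemma H1_bar_convex:
  assumes "b \<in> H1_bar"
  shows "convex (b s)"
proof -
  have "b s \<in> {{}, {point s}} \<or> convex (b s)"
    using assms by (auto simp: H1_bar_def H1_def tests_def)
  then show ?thesis
    by auto
qed

definition mass :: "real ^ 's \<Rightarrow> real" where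
  "mass \<mu> = (\<Sum>u\<in>UNIV. \<mu> $ u)"

text \<open>A Kraft-type inequality: mass at \<open>\<beta>\<close> splits among its successors
  without increase, and incomparable extensions receive disjoint parts. The induction is on the
  remaining length, grouping \<open>K\<close> by the event right after
  \<open>\<beta>\<close>.\<close>

lemma phi_antichain:
  assumes "is_scheduler E \<sigma>" and lab: "\<And>e t. e \<in> events E \<Longrightarrow> label E e t \<subseteq> dists"
    and "finite K" "K \<subseteq> traces E" "\<beta> \<in> traces E"
    and "\<And>\<gamma>. \<gamma> \<in> K \<Longrightarrow> \<exists>xs. \<gamma> = \<beta> @ xs \<and> length xs \<le> n"
    and "\<And>\<gamma> \<gamma>'. \<gamma> \<in> K \<Longrightarrow> \<gamma>' \<in> K \<Longrightarrow> prefix \<gamma> \<gamma>' \<Longrightarrow> \<gamma> = \<gamma>'"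
  shows "(\<Sum>\<gamma>\<in>K. mass (phi \<sigma> s \<gamma>)) \<le> mass (phi \<sigma> s \<beta>)"
  using assms(3-)
proof (induction n arbitrary: K \<beta>)
  case 0
  then have "K \<subseteq> {\<beta>}"
    by fastforce
  then have "K = {} \<or> K = {\<beta>}"
    by blast
  then show ?case
    using phi_nonneg[OF assms(1) \<open>\<beta> \<in> traces E\<close>] by (auto simp: mass_def intro!: sum_nonneg)
next
  case (Suc n)
  show ?case
  proof (cases "\<beta> \<in> K")
    case True
    have "K = {\<beta>}"
      using True Suc.prems(4,5) prefixI by blast
    then show ?thesis by simp
  next
    case False
    define k where "k \<gamma> = \<gamma> ! length \<beta>" for \<gamma> :: "'a list"
    have K: "\<exists>xs. \<gamma> = (\<beta> @ [k \<gamma>]) @ xs \<and> length xs \<le> n" if "\<gamma> \<in> K" for \<gamma>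
    proof -
      obtain xs where xs: "\<gamma> = \<beta> @ xs" "length xs \<le> Suc n"
        using Suc.prems(4) \<open>\<gamma> \<in> K\<close> by blast
      with False \<open>\<gamma> \<in> K\<close> show ?thesis
        by (cases xs) (auto simp: k_def)
    qed
    have tr: "\<beta> @ [k \<gamma>] \<in> traces E" if "\<gamma> \<in> K" for \<gamma>
    proof -
      have "\<exists>xs. \<gamma> = (\<beta> @ [k \<gamma>]) @ xs" "\<gamma> \<in> traces E"
        using K[OF that] that Suc.prems(2) by blast+
      then show ?thesis
        using traces_appendD by metis
    qed
    obtain w where w:
      "\<And>\<alpha> e t. \<alpha> @ [e] \<in> traces E \<Longrightarrow> scaled (label E e t) (w \<alpha> e t) (the (\<sigma> \<alpha> (e, t)))"
      "\<And>\<alpha> e t. \<alpha> @ [e] \<in> traces E \<Longrightarrow> ((\<lambda>e. w \<alpha> e t) has_sum 1) {e. \<alpha> @ [e] \<in> traces E}"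
      using scheduler_weights[OF assms(1)] by blast
    have "(\<Sum>\<gamma>\<in>K. mass (phi \<sigma> s \<gamma>)) = (\<Sum>e\<in>k ` K. \<Sum>\<gamma>\<in>{\<gamma>\<in>K. k \<gamma> = e}. mass (phi \<sigma> s \<gamma>))"
      using Suc.prems(1) by (rule sum.image_gen)
    also have "\<dots> \<le> (\<Sum>e\<in>k ` K. mass (phi \<sigma> s (\<beta> @ [e])))"
    proof (rule sum_mono)
      fix e assume "e \<in> k ` K"
      then have "\<beta> @ [e] \<in> traces E"
        using tr by blast
      then show "(\<Sum>\<gamma>\<in>{\<gamma>\<in>K. k \<gamma> = e}. mass (phi \<sigma> s \<gamma>)) \<le> mass (phi \<sigma> s (\<beta> @ [e]))"
        using Suc.prems K by (intro Suc.IH) auto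
    qed
    also have "\<dots> = (\<Sum>e\<in>k ` K. \<Sum>t\<in>UNIV. w \<beta> e t * phi \<sigma> s \<beta> $ t)"
    proof (rule sum.cong[OF refl])
      fix e assume "e \<in> k ` K"
      then have e: "\<beta> @ [e] \<in> traces E"
        using tr by blast
      then have "mass (the (\<sigma> \<beta> (e, t))) = w \<beta> e t" for t
        using scaled_mass(1)[OF lab w(1)[OF e]] unfolding mass_def by (auto simp: traces_snoc)
      then show "mass (phi \<sigma> s (\<beta> @ [e])) = (\<Sum>t\<in>UNIV. w \<beta> e t * phi \<sigma> s \<beta> $ t)"
        unfolding mass_def by (simp add: phi_snoc) (subst sum.swap, simp flip: sum_distrib_right)
    qed
    also have "\<dots> = (\<Sum>t\<in>UNIV. (\<Sum>e\<in>k ` K. w \<beta> e t) * phi \<sigma> s \<beta> $ t)"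
      by (subst sum.swap) (simp add: sum_distrib_right)
    also have "\<dots> \<le> (\<Sum>t\<in>UNIV. 1 * phi \<sigma> s \<beta> $ t)"
    proof (intro sum_mono mult_right_mono)
      fix t
      show "(\<Sum>e\<in>k ` K. w \<beta> e t) \<le> 1"
      proof (cases "K = {}")
        case False
        then obtain \<gamma> where "\<gamma> \<in> K" by blast
        show ?thesis
          using Suc.prems(1) tr scaled_nonneg[OF w(1)]
          by (intro finite_sum_le_has_sum[OF w(2)[OF tr[OF \<open>\<gamma> \<in> K\<close>], of t]]) auto
      qed simp
    qed (use phi_nonneg[OF assms(1) \<open>\<beta> \<in> traces E\<close>] in auto)
    finally show ?thesis
      by (simp add: mass_def)
  qed
qed

text \<open>The weight of a trace for a run that starts in a random state with distribution \<open>\<nu>\<close>.\<close>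

definition mix :: "real ^ 's \<Rightarrow> ('e, 's::finite) scheduler \<Rightarrow> 'e list \<Rightarrow> real ^ 's" where
  "mix \<nu> \<sigma> \<alpha> = (\<Sum>s\<in>UNIV. \<nu> $ s *\<^sub>R phi \<sigma> s \<alpha>)"

lemma mix_Nil: "mix \<nu> \<sigma> [] = \<nu>"
  by (simp add: mix_def vec_eq_iff point_def axis_def sum_component if_distrib sum.delta cong: if_cong)

lemma mix_snoc: "mix \<nu> \<sigma> (\<alpha> @ [e]) = (\<Sum>t\<in>UNIV. mix \<nu> \<sigma> \<alpha> $ t *\<^sub>R the (\<sigma> \<alpha> (e, t)))"
  unfolding mix_def vec_eq_iff
  by (simp add: sum_component phi_snoc sum_distrib_left sum_distrib_right)
    (subst sum.swap, simp add: mult_ac)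

text \<open>Of the mass \<open>F \<beta> $ t\<close> present at \<open>\<beta>\<close> in state
  \<open>t\<close>, the event \<open>e\<close> carries away \<open>g \<beta> e t\<close>,
  distributed as \<open>V \<beta> e t\<close>. The scheduler consists of the conditional
  probabilities, that is, of the quotients by \<open>F \<beta> $ t\<close>.\<close>

lemma scheduler_of_flow:
  fixes B :: "('f, 's::finite) ipbes"
  assumes lab: "\<And>e. e \<in> events B \<Longrightarrow> label B e \<in> H1_bar"
    and feas: "\<And>\<beta> e t. \<beta> @ [e] \<in> traces B \<Longrightarrow> \<exists>e'. \<beta> @ [e'] \<in> traces B \<and> label B e' t \<noteq> {}"
    and F_Nil: "F [] = \<nu>"
    and F_snoc: "\<And>\<beta> e. \<beta> @ [e] \<in> traces B \<Longrightarrow> F (\<beta> @ [e]) = (\<Sum>t\<in>UNIV. V \<beta> e t)"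
    and scaled: "\<And>\<beta> e t. \<beta> @ [e] \<in> traces B \<Longrightarrow> scaled (label B e t) (g \<beta> e t) (V \<beta> e t)"
    and balance: "\<And>\<beta> e t. \<beta> @ [e] \<in> traces B \<Longrightarrow>
      ((\<lambda>e. g \<beta> e t) has_sum F \<beta> $ t) {e. \<beta> @ [e] \<in> traces B}"
  obtains \<tau> where "is_scheduler B \<tau>" "\<And>\<beta>. \<beta> \<in> traces B \<Longrightarrow> mix \<nu> \<tau> \<beta> = F \<beta>"
proof -
  \<comment> \<open>Where no mass arrives there is nothing to normalise, yet the weights must sum to
    1. Feasibility offers an enabled event \<open>e0\<close> that takes all the weight.\<close>
  have "\<exists>e0. (\<exists>e. \<beta> @ [e] \<in> traces B) \<longrightarrow> \<beta> @ [e0] \<in> traces B \<and> label B e0 t \<noteq> {}" for \<beta> t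
    using feas by blast
  then obtain e0 where e0: "\<And>\<beta> e t. \<beta> @ [e] \<in> traces B \<Longrightarrow> \<beta> @ [e0 \<beta> t] \<in> traces B"
      "\<And>\<beta> e t. \<beta> @ [e] \<in> traces B \<Longrightarrow> label B (e0 \<beta> t) t \<noteq> {}"
    by metis
  \<comment> \<open>Outside traces the weight is set to 0, since the whole range of the weight
    function must lie in the unit interval.\<close>
  define w where "w \<beta> e t = (if \<beta> @ [e] \<notin> traces B then 0
    else if F \<beta> $ t = 0 then of_bool (e = e0 \<beta> t) else g \<beta> e t / F \<beta> $ t)" for \<beta> e t
  define x where "x \<beta> e t =
    (if F \<beta> $ t = 0 then of_bool (e = e0 \<beta> t) *\<^sub>R (SOME \<mu>. \<mu> \<in> label B (e0 \<beta> t) t)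
     else (1 / F \<beta> $ t) *\<^sub>R V \<beta> e t)" for \<beta> e t
  define \<tau> where "\<tau> \<beta> = (\<lambda>(e, t). if \<beta> @ [e] \<in> traces B then Some (x \<beta> e t) else None)" for \<beta>
  have dists: "label B e t \<subseteq> dists" if "\<beta> @ [e] \<in> traces B" for \<beta> e t
    using H1_bar_dists lab that by (auto simp: traces_snoc)
  have F_nonneg: "0 \<le> F \<beta> $ t" if "\<beta> @ [e] \<in> traces B" for \<beta> e t
    using has_sum_nonneg[OF balance[OF that]] scaled_nonneg[OF scaled] by blast
  have wx: "scaled (label B e t) (w \<beta> e t) (x \<beta> e t)" if e: "\<beta> @ [e] \<in> traces B" for \<beta> e t
  proof (cases "F \<beta> $ t = 0")
    case True
    have "(SOME \<mu>. \<mu> \<in> label B (e0 \<beta> t) t) \<in> label B (e0 \<beta> t) t"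
      using e0(2)[OF e] by (simp add: some_in_eq)
    with True e show ?thesis
      by (auto simp: w_def x_def scaled_def)
  next
    case False
    with e scaled_scaleR[OF scaled[OF e], of "1 / F \<beta> $ t" t] F_nonneg[OF e] show ?thesis
      by (simp add: w_def x_def)
  qed
  have w1: "((\<lambda>e. w \<beta> e t) has_sum 1) {e. \<beta> @ [e] \<in> traces B}" if e: "\<beta> @ [e] \<in> traces B" for \<beta> e t
  proof (cases "F \<beta> $ t = 0")
    case True
    show ?thesis
      by (rule has_sum_finite_neutralI[of "{e0 \<beta> t}"]) (use True e0(1)[OF e] in \<open>auto simp: w_def\<close>)
  next
    case False
    have "((\<lambda>e. g \<beta> e t / F \<beta> $ t) has_sum (F \<beta> $ t / F \<beta> $ t)) {e. \<beta> @ [e] \<in> traces B}"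
      by (intro has_sum_divide_const balance[OF e])
    with False show ?thesis
      by (subst has_sum_cong[where g = "\<lambda>e. g \<beta> e t / F \<beta> $ t"]) (auto simp: w_def)
  qed
  have w01: "w \<beta> e t \<in> {0..1}" for \<beta> e t
  proof (cases "\<beta> @ [e] \<in> traces B")
    case True
    then have "sum (\<lambda>e. w \<beta> e t) {e} \<le> 1"
      using scaled_nonneg[OF wx] by (intro finite_sum_le_has_sum[OF w1[OF True, of t]]) auto
    then show ?thesis
      using scaled_nonneg[OF wx[OF True]] by simp
  qed (simp add: w_def)
  have "is_scheduler B \<tau>"
    unfolding is_scheduler_def
  proof (intro ballI conjI)
    fix \<beta>
    show dom: "dom (\<tau> \<beta>) = {(e, s). \<beta> @ [e] \<in> traces B}"
      by (auto simp: \<tau>_def split: if_splits)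
    show "ran (\<tau> \<beta>) \<subseteq> subdists"
    proof
      fix v assume "v \<in> ran (\<tau> \<beta>)"
      then obtain e t where "\<beta> @ [e] \<in> traces B" "v = x \<beta> e t"
        by (auto simp: \<tau>_def ran_def split: if_splits)
      then show "v \<in> subdists"
        using scaled_mass[OF dists wx] w01 by (auto simp: subdists_def)
    qed
    have "\<exists>\<mu>\<in>label B e t. \<tau> \<beta> (e, t) = Some (w \<beta> e t *\<^sub>R \<mu>)"
      if "\<beta> @ [e] \<in> traces B" "label B e t \<noteq> {}" for e t
      using that wx[OF that(1), of t] by (auto simp: \<tau>_def scaled_def)
    moreover have "w \<beta> e t = 0 \<and> \<tau> \<beta> (e, t) = Some 0"
      if "\<beta> @ [e] \<in> traces B" "label B e t = {}" for e t
      using that wx[OF that(1), of t] by (auto simp: \<tau>_def scaled_def)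
    moreover have "\<forall>t. ((\<lambda>e. w \<beta> e t) has_sum 1) {e. \<beta> @ [e] \<in> traces B}" if "dom (\<tau> \<beta>) \<noteq> {}"
      using that w1 unfolding dom by blast
    ultimately show "\<exists>w :: 'f \<times> 's \<Rightarrow> real. range w \<subseteq> {0..1} \<and>
       (\<forall>(e, s)\<in>dom (\<tau> \<beta>).
          (label B e s \<noteq> {} \<longrightarrow> (\<exists>\<mu>\<in>label B e s. \<tau> \<beta> (e, s) = Some (w (e, s) *\<^sub>R \<mu>))) \<and>
          (label B e s = {} \<longrightarrow> w (e, s) = 0 \<and> \<tau> \<beta> (e, s) = Some 0)) \<and>
       (dom (\<tau> \<beta>) \<noteq> {} \<longrightarrow>
          (\<forall>s. ((\<lambda>e. w (e, s)) has_sum 1) {e. \<beta> @ [e] \<in> traces B}))"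
      using w01 unfolding dom by (intro exI[of _ "\<lambda>(e, t). w \<beta> e t"]) (auto simp del: atLeastAtMost_iff)
  qed
  moreover have "mix \<nu> \<tau> \<beta> = F \<beta>" if "\<beta> \<in> traces B" for \<beta>
    using that
  proof (induction \<beta> rule: rev_induct)
    case (snoc e \<beta>)
    note e = snoc.prems
    then have IH: "mix \<nu> \<tau> \<beta> = F \<beta>"
      using snoc.IH traces_appendD by blast
    \<comment> \<open>The arbitrary choice made at \<open>F \<beta> $ t = 0\<close> does no harm: by
      the balance all \<open>g \<beta> e t\<close> vanish there, and with them
      \<open>V \<beta> e t\<close>.\<close>
    have "F \<beta> $ t *\<^sub>R the (\<tau> \<beta> (e, t)) = V \<beta> e t" for t
    proof (cases "F \<beta> $ t = 0")
      case True
      then have "g \<beta> e t = 0"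
        using e scaled_nonneg[OF scaled]
        by (intro nonneg_has_sum_le_0D[OF balance[OF e, of t]]) auto
      then show ?thesis
        using True scaled_zero scaled[OF e, of t] by auto
    next
      case False
      then show ?thesis
        using e by (simp add: \<tau>_def x_def)
    qed
    then show ?case
      by (simp add: mix_snoc IH F_snoc[OF e])
  qed (simp add: mix_Nil F_Nil)
  ultimately show ?thesis
    using that by blast
qed

section \<open>Soundness of simulation\<close>

text \<open>Unlike a t-simulation, a weak simulation may map the last event of a maximal trace to
  nothing; in return the completion of a weakly maximal trace has length at most one.\<close>

locale weak_simulation =
  fixes A :: "('e, 's::finite) ipbes" and B :: "('f, 's) ipbes" and f :: "'e list \<Rightarrow> 'f list"
  assumes f_traces: "\<And>\<alpha>. \<alpha> \<in> traces A \<Longrightarrow> f \<alpha> \<in> traces B"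
    and f_Nil: "f [] = []"
    and finite_fiber: "\<And>\<beta>. finite {\<alpha> \<in> traces A. f \<alpha> = \<beta>}"
    and f_step: "\<And>\<alpha> e. \<alpha> @ [e] \<in> traces A \<Longrightarrow>
        f (\<alpha> @ [e]) = f \<alpha> \<and> label A e \<sqsubseteq>\<^sub>H skip \<or>
        (\<exists>e'. label A e \<sqsubseteq>\<^sub>H label B e' \<and> f (\<alpha> @ [e]) = f \<alpha> @ [e'])"
    and f_max: "\<And>\<alpha>. \<alpha> \<in> max_traces A \<Longrightarrow>
        f \<alpha> \<in> max_traces B \<or> (\<exists>d. f \<alpha> @ [d] \<in> max_traces B \<and> skip \<sqsubseteq>\<^sub>H label B d)"
    and label_B: "\<And>e. e \<in> events B \<Longrightarrow> label B e \<in> H1_bar"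
    and feasible_B: "feasible B"

locale simulated_scheduler = weak_simulation A B f
  for A :: "('e, 's::finite) ipbes" and B :: "('f, 's) ipbes" and f +
  fixes \<sigma> :: "('e, 's) scheduler" and \<nu> :: "real ^ 's" and w :: "'e list \<Rightarrow> 'e \<Rightarrow> 's \<Rightarrow> real"
  assumes scheduler: "is_scheduler A \<sigma>" and \<nu>_nonneg: "\<And>s. 0 \<le> \<nu> $ s"
    and w_scaled: "\<And>\<alpha> e t. \<alpha> @ [e] \<in> traces A \<Longrightarrow> scaled (label A e t) (w \<alpha> e t) (the (\<sigma> \<alpha> (e, t)))"
    and w_sum: "\<And>\<alpha> e t. \<alpha> @ [e] \<in> traces A \<Longrightarrow>
      ((\<lambda>e. w \<alpha> e t) has_sum 1) {e. \<alpha> @ [e] \<in> traces A}"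
begin

text \<open>An edge of the tree of traces is named by its lower end: this is the mass in state
  \<open>t\<close> at the parent that takes the last event. It is meaningful for non-empty traces
  only.\<close>

definition prob :: "'e list \<Rightarrow> 's \<Rightarrow> real" where
  "prob \<alpha> t = w (butlast \<alpha>) (last \<alpha>) t * mix \<nu> \<sigma> (butlast \<alpha>) $ t"

definition flow :: "'e list \<Rightarrow> 's \<Rightarrow> real ^ 's" where
  "flow \<alpha> t = mix \<nu> \<sigma> (butlast \<alpha>) $ t *\<^sub>R the (\<sigma> (butlast \<alpha>) (last \<alpha>, t))"

definition fiber :: "'f list \<Rightarrow> 'e list set" where
  "fiber \<beta> = {\<alpha> \<in> traces A. f \<alpha> = \<beta>}"

text \<open>A fibre is a forest in the tree of traces, and these are its roots. Mass is counted at
  the roots only, since it would be counted again after every invisible step.\<close>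

definition entries :: "'f list \<Rightarrow> 'e list set" where
  "entries \<beta> = {\<alpha> \<in> fiber \<beta>. \<alpha> = [] \<or> f (butlast \<alpha>) \<noteq> \<beta>}"

definition inflow :: "'f list \<Rightarrow> real ^ 's" where
  "inflow \<beta> = (\<Sum>\<alpha>\<in>entries \<beta>. mix \<nu> \<sigma> \<alpha>)"

definition stopped :: "'f list \<Rightarrow> real ^ 's" where
  "stopped \<beta> = (\<Sum>\<alpha>\<in>fiber \<beta> \<inter> max_traces A. mix \<nu> \<sigma> \<alpha>)"

text \<open>Mass that stops at a weakly maximal trace of \<open>B\<close> is sent on along this skip event.\<close>

definition final_event :: "'f list \<Rightarrow> 'f option" where
  "final_event \<beta> =
     (if \<beta> \<notin> max_traces B \<and> fiber \<beta> \<inter> max_traces A \<noteq> {}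
      then Some (SOME d. \<beta> @ [d] \<in> max_traces B \<and> skip \<sqsubseteq>\<^sub>H label B d) else None)"

definition step_prob :: "'f list \<Rightarrow> 'f \<Rightarrow> 's \<Rightarrow> real" where
  "step_prob \<beta> e t = (\<Sum>\<alpha>\<in>entries (\<beta> @ [e]). prob \<alpha> t) +
     (if final_event \<beta> = Some e then stopped \<beta> $ t else 0)"

definition step_flow :: "'f list \<Rightarrow> 'f \<Rightarrow> 's \<Rightarrow> real ^ 's" where
  "step_flow \<beta> e t = (\<Sum>\<alpha>\<in>entries (\<beta> @ [e]). flow \<alpha> t) +
     (if final_event \<beta> = Some e then stopped \<beta> $ t *\<^sub>R point t else 0)"

definition total_flow :: "'f list \<Rightarrow> real ^ 's" where
  "total_flow \<beta> = (if \<beta> = [] then \<nu> else \<Sum>t\<in>UNIV. step_flow (butlast \<beta>) (last \<beta>) t)"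

lemma finite_fiber': "finite (fiber \<beta>)"
  unfolding fiber_def by (rule finite_fiber)

lemma finite_entries: "finite (entries \<beta>)"
  unfolding entries_def using finite_fiber'[of \<beta>] by simp

lemma mix_nonneg: "\<alpha> \<in> traces A \<Longrightarrow> 0 \<le> mix \<nu> \<sigma> \<alpha> $ t"
  using phi_nonneg[OF scheduler] \<nu>_nonneg by (auto simp: mix_def sum_component intro!: sum_nonneg)

lemma stopped_nonneg: "0 \<le> stopped \<beta> $ t"
  unfolding stopped_def using mix_nonneg by (auto simp: sum_component max_traces_iff intro!: sum_nonneg)

lemma flow_scaled:
  assumes "\<alpha> @ [e] \<in> traces A"
  shows "scaled (label A e t) (prob (\<alpha> @ [e]) t) (flow (\<alpha> @ [e]) t)"
proof -
  have "\<alpha> \<in> traces A"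
    using assms traces_appendD by blast
  from scaled_scaleR[OF w_scaled[OF assms] mix_nonneg[OF this]] show ?thesis
    by (simp add: prob_def flow_def mult.commute)
qed

lemma sum_flow: "mix \<nu> \<sigma> (\<alpha> @ [e]) = (\<Sum>t\<in>UNIV. flow (\<alpha> @ [e]) t)"
  by (simp add: flow_def mix_snoc)

lemma entries_Nil: "entries [] = {[]}"
proof -
  have "\<alpha> = []" if "\<alpha> \<in> entries []" for \<alpha>
  proof (cases \<alpha> rule: rev_cases)
    case (snoc \<alpha>' e)
    with that f_step[of \<alpha>' e] show ?thesis
      by (auto simp: entries_def fiber_def)
  qed
  then show ?thesis
    by (auto simp: entries_def fiber_def f_Nil)
qed

lemma entries_snocE:
  assumes "\<alpha> \<in> entries (\<beta> @ [e'])"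
  obtains \<alpha>' e where "\<alpha> = \<alpha>' @ [e]" "\<alpha>' @ [e] \<in> traces A" "f \<alpha>' = \<beta>" "label A e \<sqsubseteq>\<^sub>H label B e'"
proof (cases \<alpha> rule: rev_cases)
  case Nil
  with assms show ?thesis
    by (auto simp: entries_def fiber_def f_Nil)
next
  case (snoc \<alpha>' e)
  with assms f_step[of \<alpha>' e] that show ?thesis
    by (auto simp: entries_def fiber_def)
qed

text \<open>A step below \<open>skip\<close> leaves the state alone, so what arrives in state
  \<open>t\<close> is exactly what left the parent in state \<open>t\<close>.\<close>

lemma stutter:
  assumes "\<alpha> @ [e] \<in> traces A" "f (\<alpha> @ [e]) = f \<alpha>"
  shows "mix \<nu> \<sigma> (\<alpha> @ [e]) $ t = prob (\<alpha> @ [e]) t"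
proof -
  have "label A e \<sqsubseteq>\<^sub>H skip"
    using f_step[OF assms(1)] assms(2) by auto
  then have *: "scaled {point t} (prob (\<alpha> @ [e]) t) (flow (\<alpha> @ [e]) t)" for t
    by (intro scaled_mono[OF flow_scaled[OF assms(1)]]) (auto simp: H_le_def skip_def)
  have "flow (\<alpha> @ [e]) t = prob (\<alpha> @ [e]) t *\<^sub>R point t" for t
    using *[of t] by (auto simp: scaled_def)
  then show ?thesis
    by (simp add: sum_flow sum_component point_def axis_def if_distrib sum.delta cong: if_cong)
qed

text \<open>Conservation of mass in a fibre, separately for each state \<open>t\<close>: invisible
  steps cancel out, and what entered either stops at a maximal trace or leaves the fibre.\<close>

lemma outflow:
  assumes "\<beta> \<in> traces B"
  shows "((\<lambda>\<alpha>. prob \<alpha> t) has_sum (inflow \<beta> $ t - stopped \<beta> $ t))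
    {\<alpha> \<in> traces A. \<alpha> \<noteq> [] \<and> f (butlast \<alpha>) = \<beta> \<and> f \<alpha> \<noteq> \<beta>}"
proof -
  define C where "C \<alpha> = (\<lambda>e. \<alpha> @ [e]) ` {e. \<alpha> @ [e] \<in> traces A}" for \<alpha>
  define m where "m \<alpha> = mix \<nu> \<sigma> \<alpha> $ t" for \<alpha>
  \<comment> \<open>The traces of the fibre reached by an invisible step; removing them from all
    children leaves the edges out of the fibre.\<close>
  define Y where "Y = fiber \<beta> - entries \<beta>"
  have C: "((\<lambda>\<alpha>. prob \<alpha> t) has_sum (if \<alpha> \<in> max_traces A then 0 else m \<alpha>)) (C \<alpha>)"
    if "\<alpha> \<in> traces A" for \<alpha>
  proof (cases "\<alpha> \<in> max_traces A")
    case True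
    then have "C \<alpha> = {}"
      by (auto simp: C_def max_traces_iff)
    with True show ?thesis by simp
  next
    case False
    with that obtain e where e: "\<alpha> @ [e] \<in> traces A"
      by (auto simp: max_traces_iff)
    have "((\<lambda>\<alpha>. prob \<alpha> t) has_sum m \<alpha>) (C \<alpha>)"
      unfolding C_def using has_sum_cmult_left[OF w_sum[OF e], of t "m \<alpha>"]
      by (subst has_sum_reindex) (auto simp: inj_on_def comp_def prob_def m_def)
    with False show ?thesis by simp
  qed
  have "((\<lambda>\<alpha>. prob \<alpha> t) has_sum (\<Sum>\<alpha>\<in>fiber \<beta>. if \<alpha> \<in> max_traces A then 0 else m \<alpha>)) (\<Union>\<alpha>\<in>fiber \<beta>. C \<alpha>)"
    by (rule sum_has_sum[OF finite_fiber' C]) (auto simp: fiber_def C_def)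
  moreover have "finite Y" "Y \<subseteq> (\<Union>\<alpha>\<in>fiber \<beta>. C \<alpha>)"
  proof -
    show "Y \<subseteq> (\<Union>\<alpha>\<in>fiber \<beta>. C \<alpha>)"
    proof
      fix \<alpha> assume "\<alpha> \<in> Y"
      then show "\<alpha> \<in> (\<Union>\<alpha>\<in>fiber \<beta>. C \<alpha>)"
        by (cases \<alpha> rule: rev_cases)
          (auto simp: Y_def entries_def fiber_def C_def dest: traces_appendD)
    qed
  qed (simp add: Y_def finite_fiber')
  ultimately have "((\<lambda>\<alpha>. prob \<alpha> t) has_sum
      ((\<Sum>\<alpha>\<in>fiber \<beta>. if \<alpha> \<in> max_traces A then 0 else m \<alpha>) - (\<Sum>\<alpha>\<in>Y. prob \<alpha> t))) ((\<Union>\<alpha>\<in>fiber \<beta>. C \<alpha>) - Y)"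
    by (rule has_sum_Diff_finite)
  moreover have "(\<Sum>\<alpha>\<in>Y. prob \<alpha> t) = (\<Sum>\<alpha>\<in>Y. m \<alpha>)"
  proof (rule sum.cong[OF refl])
    fix \<alpha> assume "\<alpha> \<in> Y"
    then show "prob \<alpha> t = m \<alpha>"
      using stutter[of "butlast \<alpha>" "last \<alpha>" t]
      by (cases \<alpha> rule: rev_cases) (auto simp: Y_def entries_def fiber_def m_def)
  qed
  moreover have "(\<Sum>\<alpha>\<in>fiber \<beta>. if \<alpha> \<in> max_traces A then 0 else m \<alpha>) =
      (\<Sum>\<alpha>\<in>fiber \<beta>. m \<alpha>) - stopped \<beta> $ t"
  proof -
    have "(\<Sum>\<alpha>\<in>fiber \<beta>. if \<alpha> \<in> max_traces A then 0 else m \<alpha>) =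
        (\<Sum>\<alpha>\<in>fiber \<beta>. m \<alpha> - (if \<alpha> \<in> max_traces A then m \<alpha> else 0))"
      by (intro sum.cong) auto
    also have "\<dots> = (\<Sum>\<alpha>\<in>fiber \<beta>. m \<alpha>) - stopped \<beta> $ t"
      by (simp add: sum_subtractf stopped_def sum_component m_def flip: sum.inter_restrict[OF finite_fiber'])
    finally show ?thesis .
  qed
  moreover have "(\<Sum>\<alpha>\<in>fiber \<beta>. m \<alpha>) = inflow \<beta> $ t + (\<Sum>\<alpha>\<in>Y. m \<alpha>)"
  proof -
    have "entries \<beta> \<subseteq> fiber \<beta>"
      by (auto simp: entries_def)
    from sum.subset_diff[OF this finite_fiber', of m] show ?thesis
      by (simp add: Y_def inflow_def m_def sum_component)
  qed
  moreover have "(\<Union>\<alpha>\<in>fiber \<beta>. C \<alpha>) - Y = {\<alpha> \<in> traces A. \<alpha> \<noteq> [] \<and> f (butlast \<alpha>) = \<beta> \<and> f \<alpha> \<noteq> \<beta>}"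
    (is "?l = ?r")
  proof (rule set_eqI)
    fix \<alpha>
    show "\<alpha> \<in> ?l \<longleftrightarrow> \<alpha> \<in> ?r"
      by (cases \<alpha> rule: rev_cases) (auto simp: Y_def entries_def fiber_def C_def dest: traces_appendD)
  qed
  ultimately show ?thesis by simp
qed

text \<open>No edge can leave the fibre of a maximal trace, so the sum in \<open>outflow\<close> is
  empty.\<close>

lemma inflow_max:
  assumes "\<beta> \<in> max_traces B"
  shows "inflow \<beta> = stopped \<beta>"
proof -
  have \<beta>: "\<beta> \<in> traces B" "\<And>e. \<beta> @ [e] \<notin> traces B"
    using assms by (auto simp: max_traces_iff)
  have empty: "{\<alpha> \<in> traces A. \<alpha> \<noteq> [] \<and> f (butlast \<alpha>) = \<beta> \<and> f \<alpha> \<noteq> \<beta>} = {}"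
  proof -
    have False if "\<alpha> \<in> traces A" "\<alpha> \<noteq> []" "f (butlast \<alpha>) = \<beta>" "f \<alpha> \<noteq> \<beta>" for \<alpha>
      using that f_step[of "butlast \<alpha>" "last \<alpha>"] f_traces[of \<alpha>] \<beta>(2) by auto
    then show ?thesis by blast
  qed
  have "inflow \<beta> $ t - stopped \<beta> $ t = 0" for t
    using outflow[OF \<beta>(1), of t] has_sum_empty unfolding empty by (rule has_sum_unique)
  then show ?thesis
    by (simp add: vec_eq_iff)
qed

lemma final_event:
  assumes "final_event \<beta> = Some d"
  shows "\<beta> @ [d] \<in> max_traces B" "skip \<sqsubseteq>\<^sub>H label B d" "\<beta> \<notin> max_traces B"
proof -
  from assms obtain \<alpha> where *: "\<alpha> \<in> max_traces A" "f \<alpha> = \<beta>" "\<beta> \<notin> max_traces B"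
    "d = (SOME d. \<beta> @ [d] \<in> max_traces B \<and> skip \<sqsubseteq>\<^sub>H label B d)"
    by (auto simp: final_event_def fiber_def split: if_splits)
  then have "\<exists>d. \<beta> @ [d] \<in> max_traces B \<and> skip \<sqsubseteq>\<^sub>H label B d"
    using f_max[OF *(1)] by auto
  from someI_ex[OF this] show "\<beta> @ [d] \<in> max_traces B" "skip \<sqsubseteq>\<^sub>H label B d"
    unfolding *(4) by auto
  show "\<beta> \<notin> max_traces B" by fact
qed

lemma final_event_None:
  assumes "final_event \<beta> = None" "\<beta> \<notin> max_traces B"
  shows "stopped \<beta> = 0"
proof -
  have "fiber \<beta> \<inter> max_traces A = {}"
    using assms by (auto simp: final_event_def split: if_splits)
  then show ?thesis
    by (simp only: stopped_def sum.empty)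
qed

lemma total_flow_snoc:
  "total_flow (\<beta> @ [e]) = inflow (\<beta> @ [e]) + (if final_event \<beta> = Some e then stopped \<beta> else 0)"
proof -
  have "(\<Sum>t\<in>UNIV. \<Sum>\<alpha>\<in>entries (\<beta> @ [e]). flow \<alpha> t) = (\<Sum>\<alpha>\<in>entries (\<beta> @ [e]). \<Sum>t\<in>UNIV. flow \<alpha> t)"
    by (rule sum.swap)
  also have "\<dots> = inflow (\<beta> @ [e])"
    unfolding inflow_def
  proof (rule sum.cong[OF refl])
    fix \<alpha> assume "\<alpha> \<in> entries (\<beta> @ [e])"
    then show "(\<Sum>t\<in>UNIV. flow \<alpha> t) = mix \<nu> \<sigma> \<alpha>"
      by (elim entries_snocE) (simp add: sum_flow)
  qed
  finally have "(\<Sum>t\<in>UNIV. \<Sum>\<alpha>\<in>entries (\<beta> @ [e]). flow \<alpha> t) = inflow (\<beta> @ [e])" .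
  moreover have "(\<Sum>t\<in>UNIV. stopped \<beta> $ t *\<^sub>R point t) = stopped \<beta>"
    by (simp add: vec_eq_iff sum_component point_def axis_def if_distrib sum.delta cong: if_cong)
  ultimately show ?thesis
    by (simp add: total_flow_def step_flow_def sum.distrib)
qed

text \<open>Redirected mass lands on maximal traces only, so elsewhere it adds nothing to the
  inflow.\<close>

lemma total_flow_nonmax:
  assumes "\<beta> \<in> traces B - max_traces B"
  shows "total_flow \<beta> = inflow \<beta>"
proof (cases \<beta> rule: rev_cases)
  case Nil
  then show ?thesis
    by (simp add: total_flow_def inflow_def entries_Nil mix_Nil)
next
  case (snoc \<beta>' e)
  with assms show ?thesis
    using final_event(1)[of \<beta>' e] by (auto simp: total_flow_snoc)
qed

text \<open>Convexity of labels enters here: edges from many traces of \<open>A\<close> are merged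
  into one edge of \<open>B\<close>, each with its own distribution from a smaller label. Redirected
  mass fits since \<open>final_event\<close> is labelled above \<open>skip\<close>.\<close>

lemma step_flow_scaled:
  assumes "\<beta> @ [e'] \<in> traces B"
  shows "scaled (label B e' t) (step_prob \<beta> e' t) (step_flow \<beta> e' t)"
proof -
  have conv: "convex (label B e' t)"
    using H1_bar_convex[OF label_B] assms by (simp add: traces_snoc)
  have "scaled (label B e' t) (\<Sum>\<alpha>\<in>entries (\<beta> @ [e']). prob \<alpha> t) (\<Sum>\<alpha>\<in>entries (\<beta> @ [e']). flow \<alpha> t)"
  proof (rule scaled_sum[OF conv])
    fix \<alpha> assume "\<alpha> \<in> entries (\<beta> @ [e'])"
    then obtain \<alpha>' e where "\<alpha> = \<alpha>' @ [e]" "\<alpha>' @ [e] \<in> traces A" "label A e \<sqsubseteq>\<^sub>H label B e'"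
      by (elim entries_snocE)
    then show "scaled (label B e' t) (prob \<alpha> t) (flow \<alpha> t)"
      using scaled_mono[OF flow_scaled] by (simp add: H_le_def)
  qed
  moreover have "scaled (label B e' t) (stopped \<beta> $ t) (stopped \<beta> $ t *\<^sub>R point t)"
    if "final_event \<beta> = Some e'"
    using final_event(2)[OF that] stopped_nonneg by (auto simp: scaled_def H_le_def skip_def)
  ultimately show ?thesis
    unfolding step_prob_def step_flow_def by (intro scaled_add[OF conv]) simp_all
qed

text \<open>Edges that leave the fibre are grouped by the event of \<open>B\<close> they map to, and
  \<open>final_event\<close> adds the mass that \<open>outflow\<close> reports as stopped.\<close>

lemma step_prob_balance:
  assumes "\<beta> @ [e'] \<in> traces B"
  shows "((\<lambda>e'. step_prob \<beta> e' t) has_sum total_flow \<beta> $ t) {e'. \<beta> @ [e'] \<in> traces B}"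
proof -
  have \<beta>: "\<beta> \<in> traces B - max_traces B"
    using assms traces_appendD by (auto simp: max_traces_iff)
  have "((\<lambda>e'. \<Sum>\<alpha>\<in>entries (\<beta> @ [e']). prob \<alpha> t) has_sum (inflow \<beta> $ t - stopped \<beta> $ t))
      {e'. \<beta> @ [e'] \<in> traces B}"
  proof (rule has_sum_group[where k = "\<lambda>\<alpha>. last (f \<alpha>)"])
    let ?X = "{\<alpha> \<in> traces A. \<alpha> \<noteq> [] \<and> f (butlast \<alpha>) = \<beta> \<and> f \<alpha> \<noteq> \<beta>}"
    show "((\<lambda>\<alpha>. prob \<alpha> t) has_sum (inflow \<beta> $ t - stopped \<beta> $ t)) ?X"
      using \<beta> by (intro outflow) auto
    have X: "f \<alpha> = \<beta> @ [last (f \<alpha>)]" if "\<alpha> \<in> ?X" for \<alpha>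
      using that f_step[of "butlast \<alpha>" "last \<alpha>"] by auto
    show "last (f \<alpha>) \<in> {e'. \<beta> @ [e'] \<in> traces B}" if "\<alpha> \<in> ?X" for \<alpha>
      using X[OF that] f_traces[of \<alpha>] that by auto
    have "{\<alpha> \<in> ?X. last (f \<alpha>) = e} = entries (\<beta> @ [e])" for e
    proof (rule set_eqI, rule iffI)
      fix \<alpha> assume "\<alpha> \<in> {\<alpha> \<in> ?X. last (f \<alpha>) = e}"
      then show "\<alpha> \<in> entries (\<beta> @ [e])"
        using X[of \<alpha>] by (auto simp: entries_def fiber_def)
    next
      fix \<alpha> assume *: "\<alpha> \<in> entries (\<beta> @ [e])"
      then have "\<alpha> \<noteq> []" "f (butlast \<alpha>) = \<beta>"
        by (auto elim: entries_snocE)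
      with * show "\<alpha> \<in> {\<alpha> \<in> ?X. last (f \<alpha>) = e}"
        by (auto simp: entries_def fiber_def)
    qed
    then show "((\<lambda>\<alpha>. prob \<alpha> t) has_sum (\<Sum>\<alpha>\<in>entries (\<beta> @ [e]). prob \<alpha> t)) {\<alpha> \<in> ?X. last (f \<alpha>) = e}" for e
      by (simp add: finite_entries)
  qed
  moreover have "((\<lambda>e'. if final_event \<beta> = Some e' then stopped \<beta> $ t else 0) has_sum stopped \<beta> $ t)
      {e'. \<beta> @ [e'] \<in> traces B}"
  proof (cases "final_event \<beta>")
    case None
    then show ?thesis
      using final_event_None[OF None] \<beta> by simp
  next
    case (Some d)
    then have "\<beta> @ [d] \<in> traces B"
      using final_event(1)[OF Some] by (simp add: max_traces_iff)
    then show ?thesis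
      by (intro has_sum_finite_neutralI[of "{d}"]) (auto simp: Some)
  qed
  ultimately have "((\<lambda>e'. step_prob \<beta> e' t) has_sum (inflow \<beta> $ t - stopped \<beta> $ t + stopped \<beta> $ t))
      {e'. \<beta> @ [e'] \<in> traces B}"
    unfolding step_prob_def by (rule has_sum_add)
  then show ?thesis
    by (simp add: total_flow_nonmax[OF \<beta>])
qed

lemma simulating_scheduler:
  obtains \<tau> where "is_scheduler B \<tau>" "\<And>\<beta>. \<beta> \<in> traces B \<Longrightarrow> mix \<nu> \<tau> \<beta> = total_flow \<beta>"
proof (rule scheduler_of_flow[where g = step_prob and V = step_flow and F = total_flow and \<nu> = \<nu> and B = B])
  show "\<exists>e'. \<beta> @ [e'] \<in> traces B \<and> label B e' t \<noteq> {}" if "\<beta> @ [e] \<in> traces B" for \<beta> e t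
  proof -
    have "\<beta> \<in> traces B - max_traces B"
      using that traces_appendD by (auto simp: max_traces_iff)
    then have "t \<in> (\<Union>e\<in>{e. \<beta> @ [e] \<in> traces B}. {s. label B e s \<noteq> {}})"
      using feasible_B unfolding feasible_def by blast
    then show ?thesis by blast
  qed
qed (use label_B step_flow_scaled step_prob_balance that in \<open>auto simp: total_flow_def\<close>)

text \<open>All terminating mass of \<open>A\<close> stops in some fibre. Over a maximal trace of
  \<open>B\<close> it has arrived; elsewhere it moves on by one skip event to a maximal
  trace.\<close>

lemma has_sum_total_flow:
  assumes "(mix \<nu> \<sigma> has_sum \<mu>) (max_traces A)"
  shows "(total_flow has_sum \<mu>) (max_traces B)"
proof -
  have max_sub: "max_traces B \<subseteq> traces B"
    by (auto simp: max_traces_iff)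
  have stop: "(stopped has_sum \<mu>) (traces B)"
  proof (rule has_sum_group[OF assms, where k = f])
    show "f \<alpha> \<in> traces B" if "\<alpha> \<in> max_traces A" for \<alpha>
      using that f_traces by (auto simp: max_traces_iff)
    show "(mix \<nu> \<sigma> has_sum stopped \<beta>) {\<alpha> \<in> max_traces A. f \<alpha> = \<beta>}" for \<beta>
    proof -
      have "{\<alpha> \<in> max_traces A. f \<alpha> = \<beta>} = fiber \<beta> \<inter> max_traces A"
        by (auto simp: fiber_def max_traces_iff)
      then show ?thesis
        using finite_fiber'[of \<beta>] by (simp add: stopped_def)
    qed
  qed
  define \<mu>1 where "\<mu>1 = infsum stopped (max_traces B)"
  define \<mu>2 where "\<mu>2 = infsum stopped (traces B - max_traces B)"
  have "stopped summable_on traces B"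
    using stop has_sum_imp_summable by blast
  then have "stopped summable_on max_traces B" "stopped summable_on (traces B - max_traces B)"
    using summable_on_subset_banach max_sub by blast+
  then have sum1: "(stopped has_sum \<mu>1) (max_traces B)"
    and sum2: "(stopped has_sum \<mu>2) (traces B - max_traces B)"
    by (simp_all add: \<mu>1_def \<mu>2_def)
  have \<mu>: "\<mu> = \<mu>1 + \<mu>2"
  proof -
    have "max_traces B \<union> (traces B - max_traces B) = traces B"
      using max_sub by blast
    then show ?thesis
      using has_sum_Un_disjoint[OF sum1 sum2] stop has_sum_unique by fastforce
  qed
  \<comment> \<open>\<open>h\<close> carries each trace with a final event to its completion and is
    injective, as dropping the last event undoes it. \<open>c\<close> is the redirected mass seen
    from the completion, so the sum over non-maximal traces can be reindexed to maximal
    ones.\<close>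
  define Z where "Z = {\<beta>. final_event \<beta> \<noteq> None}"
  define h where "h \<beta> = \<beta> @ [the (final_event \<beta>)]" for \<beta>
  define c where "c \<beta> = (if \<beta> \<noteq> [] \<and> final_event (butlast \<beta>) = Some (last \<beta>) then stopped (butlast \<beta>) else 0)"
    for \<beta>
  have h_max: "h \<beta> \<in> max_traces B" if "\<beta> \<in> Z" for \<beta>
    using that final_event(1) by (auto simp: h_def Z_def)
  have Z_sub: "Z \<subseteq> traces B - max_traces B"
  proof
    fix \<beta> assume "\<beta> \<in> Z"
    then have "\<beta> \<in> traces B"
      using h_max[of \<beta>] traces_appendD by (auto simp: h_def max_traces_iff)
    with \<open>\<beta> \<in> Z\<close> show "\<beta> \<in> traces B - max_traces B"
      using final_event(3) by (auto simp: Z_def)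
  qed
  have "(stopped has_sum \<mu>2) Z"
    using sum2 Z_sub final_event_None
    by (subst has_sum_cong_neutral[where g = stopped and T = "traces B - max_traces B"]) (auto simp: Z_def)
  moreover have "c \<circ> h = (\<lambda>\<beta>. if \<beta> \<in> Z then stopped \<beta> else 0)"
    by (auto simp: c_def h_def Z_def fun_eq_iff)
  ultimately have "((c \<circ> h) has_sum \<mu>2) Z"
    by (subst has_sum_cong[where g = stopped]) auto
  then have "(c has_sum \<mu>2) (h ` Z)"
    by (subst has_sum_reindex) (auto simp: inj_on_def h_def)
  moreover have "c \<beta> = 0" if "\<beta> \<notin> h ` Z" for \<beta>
  proof (cases \<beta> rule: rev_cases)
    case (snoc \<beta>' e)
    have "final_event \<beta>' \<noteq> Some e"
      using that snoc by (force simp: h_def Z_def image_iff)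
    then show ?thesis
      by (simp add: c_def snoc)
  qed (simp add: c_def)
  ultimately have "(c has_sum \<mu>2) (max_traces B)"
    using h_max by (subst has_sum_cong_neutral[where g = c and T = "h ` Z"]) auto
  then have "((\<lambda>\<beta>. stopped \<beta> + c \<beta>) has_sum \<mu>) (max_traces B)"
    unfolding \<mu> by (rule has_sum_add[OF sum1])
  moreover have "total_flow \<beta> = stopped \<beta> + c \<beta>" if "\<beta> \<in> max_traces B" for \<beta>
  proof (cases \<beta> rule: rev_cases)
    case Nil
    then have "total_flow \<beta> = inflow \<beta>"
      by (simp add: total_flow_def inflow_def entries_Nil mix_Nil)
    then show ?thesis
      using inflow_max[OF that] by (simp add: c_def Nil)
  next
    case (snoc \<beta>' e)
    then show ?thesis
      using inflow_max[OF that] by (simp add: c_def total_flow_snoc)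
  qed
  ultimately show ?thesis
    by (subst has_sum_cong[where g = "\<lambda>\<beta>. stopped \<beta> + c \<beta>"]) auto
qed

end

section \<open>From flows to the order on semantics\<close>

lemma has_sum_sum:
  fixes f :: "'i \<Rightarrow> 'a \<Rightarrow> 'c :: topological_comm_monoid_add"
  assumes "\<And>i. i \<in> I \<Longrightarrow> (f i has_sum s i) A"
  shows "((\<lambda>a. \<Sum>i\<in>I. f i a) has_sum (\<Sum>i\<in>I. s i)) A"
  using assms by (induction I rule: infinite_finite_induct) (auto intro: has_sum_add)

lemma has_sum_mass:
  assumes "(f has_sum \<mu>) A"
  shows "((\<lambda>a. mass (f a)) has_sum mass \<mu>) A"
  unfolding mass_def using assms by (intro has_sum_sum) (simp add: has_sum_vec_iff)

text \<open>The infinite sum of a non-summable family is 0 by convention. As 0 is no distribution,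
  membership in \<open>Sched1\<close> forces summability.\<close>

lemma has_sum_outcome:
  assumes "\<sigma> \<in> Sched1 E"
  shows "(phi \<sigma> s has_sum outcome E \<sigma> s) (max_traces E)"
proof (cases "phi \<sigma> s summable_on max_traces E")
  case False
  then have "outcome E \<sigma> s = 0"
    unfolding outcome_def by (rule infsum_not_exists)
  moreover have "outcome E \<sigma> s \<in> dists"
    using assms by (auto simp: Sched1_def)
  ultimately show ?thesis
    by (simp add: dists_def)
qed (simp add: outcome_def)

lemma dists_norm_le: "\<mu> \<in> dists \<Longrightarrow> norm \<mu> \<le> 1"
  using norm_le_l1_cart[of \<mu>] by (simp add: dists_def)

context weak_simulation
begin

text \<open>The flow determines averages over \<open>\<nu>\<close> only. Positivity of
  \<open>\<nu>\<close> passes summability and total mass 1 from the average to every single initial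
  state.\<close>

lemma Sched1_mixture:
  assumes \<sigma>: "\<sigma> \<in> Sched1 A" and \<nu>: "\<And>s. 0 < \<nu> $ s"
  obtains \<tau> where "\<tau> \<in> Sched1 B"
    "(\<Sum>s\<in>UNIV. \<nu> $ s *\<^sub>R outcome B \<tau> s) = (\<Sum>s\<in>UNIV. \<nu> $ s *\<^sub>R outcome A \<sigma> s)"
proof -
  define \<mu> where "\<mu> = (\<Sum>s\<in>UNIV. \<nu> $ s *\<^sub>R outcome A \<sigma> s)"
  have sched: "is_scheduler A \<sigma>" and outcome_A: "\<And>s. outcome A \<sigma> s \<in> dists"
    using \<sigma> by (auto simp: Sched1_def)
  obtain w where
    "\<And>\<alpha> e t. \<alpha> @ [e] \<in> traces A \<Longrightarrow> scaled (label A e t) (w \<alpha> e t) (the (\<sigma> \<alpha> (e, t)))"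
    "\<And>\<alpha> e t. \<alpha> @ [e] \<in> traces A \<Longrightarrow> ((\<lambda>e. w \<alpha> e t) has_sum 1) {e. \<alpha> @ [e] \<in> traces A}"
    using scheduler_weights[OF sched] by blast
  then interpret simulated_scheduler A B f \<sigma> \<nu> w
    by unfold_locales (use sched \<nu> less_imp_le in blast)+
  obtain \<tau> where \<tau>: "is_scheduler B \<tau>" "\<And>\<beta>. \<beta> \<in> traces B \<Longrightarrow> mix \<nu> \<tau> \<beta> = total_flow \<beta>"
    using simulating_scheduler by blast
  have "(mix \<nu> \<sigma> has_sum \<mu>) (max_traces A)"
    unfolding \<mu>_def mix_def by (intro has_sum_sum has_sum_scaleR has_sum_outcome \<sigma>)
  then have "(total_flow has_sum \<mu>) (max_traces B)"
    by (rule has_sum_total_flow)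
  then have mix_\<tau>: "(mix \<nu> \<tau> has_sum \<mu>) (max_traces B)"
    using \<tau>(2) by (subst has_sum_cong[where g = total_flow]) (auto simp: max_traces_iff)
  have phi_0: "0 \<le> phi \<tau> s \<beta> $ u" if "\<beta> \<in> max_traces B" for s \<beta> u
    using that phi_nonneg[OF \<tau>(1)] by (auto simp: max_traces_iff)
  \<comment> \<open>Each \<open>phi \<tau> s\<close> is one of the non-negative summands of
    \<open>mix\<close>, hence at most \<open>mix\<close> divided by
    \<open>\<nu> $ s\<close>.\<close>
  have "(\<lambda>\<beta>. phi \<tau> s \<beta> $ u) summable_on max_traces B" for s u
  proof (rule summable_on_comparison_test)
    show "(\<lambda>\<beta>. mix \<nu> \<tau> \<beta> $ u / \<nu> $ s) summable_on max_traces B"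
      using mix_\<tau> unfolding has_sum_vec_iff
      by (intro has_sum_imp_summable[OF has_sum_divide_const]) blast
    fix \<beta> assume "\<beta> \<in> max_traces B"
    note phi_0 = phi_0[OF this]
    have "\<nu> $ s * phi \<tau> s \<beta> $ u \<le> (\<Sum>s\<in>UNIV. \<nu> $ s * phi \<tau> s \<beta> $ u)"
      using phi_0 \<nu> by (intro member_le_sum) (auto simp: less_imp_le)
    then show "phi \<tau> s \<beta> $ u \<le> mix \<nu> \<tau> \<beta> $ u / \<nu> $ s"
      using \<nu>[of s] by (simp add: mix_def sum_component field_simps)
    show "0 \<le> phi \<tau> s \<beta> $ u" by (rule phi_0)
  qed
  then have "(phi \<tau> s has_sum (\<chi> u. infsum (\<lambda>\<beta>. phi \<tau> s \<beta> $ u) (max_traces B))) (max_traces B)" for s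
    unfolding has_sum_vec_iff by simp
  then have "phi \<tau> s summable_on max_traces B" for s
    using has_sum_imp_summable by blast
  then have outcome_B: "(phi \<tau> s has_sum outcome B \<tau> s) (max_traces B)" for s
    by (simp add: outcome_def)
  have "(mix \<nu> \<tau> has_sum (\<Sum>s\<in>UNIV. \<nu> $ s *\<^sub>R outcome B \<tau> s)) (max_traces B)"
    unfolding mix_def by (intro has_sum_sum has_sum_scaleR outcome_B)
  with mix_\<tau> have \<mu>: "(\<Sum>s\<in>UNIV. \<nu> $ s *\<^sub>R outcome B \<tau> s) = \<mu>"
    using has_sum_unique by blast
  \<comment> \<open>Maximal traces are pairwise incomparable, so \<open>phi_antichain\<close> from
    the empty trace applies. The mass defects are then non-negative with average 0, so each of them
    is 0.\<close>
  have mass_le: "mass (outcome B \<tau> s) \<le> 1" for s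
  proof (rule has_sum_le_finite_sums[OF has_sum_mass[OF outcome_B]])
    fix K assume K: "finite K" "K \<subseteq> max_traces B"
    have "(\<Sum>\<gamma>\<in>K. mass (phi \<tau> s \<gamma>)) \<le> mass (phi \<tau> s [])"
    proof (rule phi_antichain[OF \<tau>(1)])
      show "label B e t \<subseteq> dists" if "e \<in> events B" for e t
        using label_B[OF that] H1_bar_dists by blast
      show "K \<subseteq> traces B" "\<And>\<gamma> \<gamma>'. \<gamma> \<in> K \<Longrightarrow> \<gamma>' \<in> K \<Longrightarrow> prefix \<gamma> \<gamma>' \<Longrightarrow> \<gamma> = \<gamma>'"
        using K(2) by (auto simp: max_traces_def)
      show "\<exists>xs. \<gamma> = [] @ xs \<and> length xs \<le> (\<Sum>\<gamma>\<in>K. length \<gamma>)" if "\<gamma> \<in> K" for \<gamma>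
        using that K(1) member_le_sum[of \<gamma> K length] by simp
    qed (use K in auto)
    then show "(\<Sum>\<gamma>\<in>K. mass (phi \<tau> s \<gamma>)) \<le> 1"
      using point_in_dists[of s] by (simp add: mass_def dists_def)
  qed
  have "(\<Sum>s\<in>UNIV. \<nu> $ s * mass (outcome B \<tau> s)) = mass \<mu>"
    unfolding mass_def \<mu>[symmetric] sum_component
    by (subst sum.swap) (simp add: sum_distrib_left)
  also have "\<dots> = (\<Sum>s\<in>UNIV. \<nu> $ s * mass (outcome A \<sigma> s))"
    unfolding mass_def \<mu>_def sum_component
    by (subst sum.swap) (simp add: sum_distrib_left)
  also have "\<dots> = (\<Sum>s\<in>UNIV. \<nu> $ s)"
    using outcome_A by (simp add: mass_def dists_def)
  finally have "(\<Sum>s\<in>UNIV. \<nu> $ s * (1 - mass (outcome B \<tau> s))) = 0"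
    by (simp add: right_diff_distrib sum_subtractf)
  moreover have "0 \<le> \<nu> $ s * (1 - mass (outcome B \<tau> s))" for s
    using \<nu>[of s] mass_le[of s] by simp
  ultimately have "\<forall>s\<in>UNIV. \<nu> $ s * (1 - mass (outcome B \<tau> s)) = 0"
    by (subst (asm) sum_nonneg_eq_0_iff) auto
  moreover have "\<nu> $ s \<noteq> 0" for s
    using \<nu>[of s] by linarith
  ultimately have "mass (outcome B \<tau> s) = 1" for s
    by simp
  moreover have "0 \<le> outcome B \<tau> s $ u" for s u
    using outcome_B[of s, unfolded has_sum_vec_iff, rule_format, of u] phi_0 by (rule has_sum_nonneg)
  ultimately have "\<tau> \<in> Sched1 B"
    using \<tau>(1) by (auto simp: Sched1_def dists_def mass_def)
  with that \<mu> show ?thesis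
    by (simp add: \<mu>_def)
qed

text \<open>A scheduler does not see the initial state. Simulating the start in \<open>s\<close> alone would
  leave its behaviour from other states open; a random initial state that is \<open>s\<close> with
  probability close to \<open>1\<close> controls all of them at once.\<close>

lemma Sched1_approximation:
  assumes \<sigma>: "\<sigma> \<in> Sched1 A" and \<epsilon>: "0 < \<epsilon>"
  obtains \<tau> where "\<tau> \<in> Sched1 B" "dist (outcome B \<tau> s) (outcome A \<sigma> s) < \<epsilon>"
proof -
  \<comment> \<open>\<open>\<nu>\<close> below puts weight 1 - \<delta> on \<open>s\<close> and
    spreads \<delta> uniformly. Outcomes differ by at most 2 in norm and their average difference is
    0, so (1 - \<delta>) times the difference at \<open>s\<close> is at most 2 \<delta>. With
    \<delta> at most 1/2 that difference is at most 4 \<delta>, and \<epsilon>/8 keeps it strictly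
    below \<epsilon>.\<close>
  define \<delta> where "\<delta> = min (1/2) (\<epsilon>/8)"
  have \<delta>: "0 < \<delta>" "\<delta> \<le> 1/2" "4 * \<delta> < \<epsilon>"
    using \<epsilon> by (auto simp: \<delta>_def min_def)
  define \<nu> :: "real ^ 's" where "\<nu> = (\<chi> t. \<delta> / real CARD('s) + (if t = s then 1 - \<delta> else 0))"
  have \<nu>_pos: "0 < \<nu> $ t" for t
    using \<delta> by (auto simp: \<nu>_def intro: add_pos_nonneg)
  obtain \<tau> where \<tau>: "\<tau> \<in> Sched1 B"
    "(\<Sum>t\<in>UNIV. \<nu> $ t *\<^sub>R outcome B \<tau> t) = (\<Sum>t\<in>UNIV. \<nu> $ t *\<^sub>R outcome A \<sigma> t)"
    using Sched1_mixture[OF \<sigma> \<nu>_pos] by blast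
  define x where "x t = outcome B \<tau> t - outcome A \<sigma> t" for t
  have x: "norm (x t) \<le> 2" for t
  proof -
    have "norm (outcome B \<tau> t) \<le> 1" "norm (outcome A \<sigma> t) \<le> 1"
      using \<tau>(1) \<sigma> by (auto intro!: dists_norm_le simp: Sched1_def)
    then show ?thesis
      unfolding x_def by norm
  qed
  have "0 = (\<Sum>t\<in>UNIV. \<nu> $ t *\<^sub>R x t)"
    using \<tau>(2) by (simp add: x_def scaleR_diff_right sum_subtractf)
  also have "\<dots> = (\<Sum>t\<in>UNIV. (\<delta> / real CARD('s)) *\<^sub>R x t) + (1 - \<delta>) *\<^sub>R x s"
    by (simp add: \<nu>_def scaleR_add_left sum.distrib if_distrib[of "\<lambda>c. c *\<^sub>R _"] sum.delta cong: if_cong)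
  finally have "(1 - \<delta>) *\<^sub>R x s = - (\<Sum>t\<in>UNIV. (\<delta> / real CARD('s)) *\<^sub>R x t)"
    by (simp add: eq_neg_iff_add_eq_0 add.commute)
  then have "norm ((1 - \<delta>) *\<^sub>R x s) = norm (\<Sum>t\<in>UNIV. (\<delta> / real CARD('s)) *\<^sub>R x t)"
    by simp
  also have "\<dots> \<le> (\<Sum>t\<in>(UNIV :: 's set). \<delta> / real CARD('s) * 2)"
    using x \<delta> by (intro sum_norm_le) (auto intro!: mult_left_mono divide_right_mono)
  also have "\<dots> = 2 * \<delta>"
    by simp
  finally have "(1 - \<delta>) * norm (x s) \<le> 2 * \<delta>"
    using \<delta> by simp
  moreover have "1/2 * norm (x s) \<le> (1 - \<delta>) * norm (x s)"
    using \<delta> by (intro mult_right_mono) auto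
  ultimately have "norm (x s) < \<epsilon>"
    using \<delta> by linarith
  then show ?thesis
    using that \<tau>(1) by (simp add: x_def dist_norm)
qed

text \<open>Approximation suffices because \<open>sem B s\<close> is closed; being convex as well,
  it contains the closed hull once it contains the outcomes.\<close>

lemma sem_le: "A \<sqsubseteq> B"
proof -
  have "outcome A \<sigma> s \<in> sem B s" if \<sigma>: "\<sigma> \<in> Sched1 A" for \<sigma> s
    unfolding sem_def closure_approachable
  proof (intro allI impI)
    fix \<epsilon> :: real assume "0 < \<epsilon>"
    then obtain \<tau> where "\<tau> \<in> Sched1 B" "dist (outcome B \<tau> s) (outcome A \<sigma> s) < \<epsilon>"
      using Sched1_approximation[OF \<sigma>] by blast
    then show "\<exists>y\<in>convex hull {outcome B \<sigma> s |\<sigma>. \<sigma> \<in> Sched1 B}. dist y (outcome A \<sigma> s) < \<epsilon>"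
      by (intro bexI[of _ "outcome B \<tau> s"]) (auto intro: hull_inc)
  qed
  moreover have "convex (sem B s)" "closed (sem B s)" for s
    by (simp_all add: sem_def convex_closure)
  ultimately have "sem A s \<subseteq> sem B s" for s
    unfolding sem_def[of A] by (intro closure_minimal hull_minimal) auto
  then show ?thesis
    by (simp add: sem_le_def H_le_def)
qed

end

section \<open>Absorbing a component into the rely\<close>

lemma labels_par:
  assumes "\<And>e. e \<in> events E \<Longrightarrow> label E e \<in> H1_bar" "\<And>e. e \<in> events F \<Longrightarrow> label F e \<in> H1_bar"
    and "e \<in> events (E \<parallel>\<^sub>E F)"
  shows "label (E \<parallel>\<^sub>E F) e \<in> H1_bar"
  using assms by (auto simp: par_def)

lemma labels_seq:
  assumes "\<And>e. e \<in> events E \<Longrightarrow> label E e \<in> H1_bar" "\<And>e. e \<in> events F \<Longrightarrow> label F e \<in> H1_bar"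
    and "e \<in> events (E \<cdot>\<^sub>E F)"
  shows "label (E \<cdot>\<^sub>E F) e \<in> H1_bar"
  using assms by (auto simp: seq_def)

lemma labels_star: "r \<in> H1 \<Longrightarrow> label (star r) e \<in> H1_bar"
  by (cases e) (auto simp: H1_bar_def tests_def skip_def)

section \<open>Feasibility of composed structures\<close>

lemma feasible_iff:
  "feasible E \<longleftrightarrow>
     (\<forall>\<alpha> e s. \<alpha> @ [e] \<in> traces E \<longrightarrow> (\<exists>e'. \<alpha> @ [e'] \<in> traces E \<and> label E e' s \<noteq> {}))"
proof -
  have "traces E - max_traces E = {\<alpha>. \<exists>e. \<alpha> @ [e] \<in> traces E}"
    by (auto simp: max_traces_iff dest: traces_appendD)
  moreover have "(\<Union>e\<in>{e. \<alpha> @ [e] \<in> traces E}. {s. label E e s \<noteq> {}}) = UNIV \<longleftrightarrow>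
      (\<forall>s. \<exists>e. \<alpha> @ [e] \<in> traces E \<and> label E e s \<noteq> {})" for \<alpha>
    by blast
  ultimately show ?thesis
    unfolding feasible_def by simp
qed

lemma feasible_star:
  assumes "r \<in> H1"
  shows "feasible (star r)"
proof -
  have "label (star r) e s \<noteq> {}" for e s
    using assms by (cases e) (auto simp: H1_def skip_def)
  then show ?thesis
    unfolding feasible_iff by blast
qed

lemma feasible_par:
  assumes "feasible E" "feasible F"
  shows "feasible (E \<parallel>\<^sub>E F)"
  unfolding feasible_iff
proof (intro allI impI)
  fix \<alpha> x s assume *: "\<alpha> @ [x] \<in> traces (E \<parallel>\<^sub>E F)"
  show "\<exists>y. \<alpha> @ [y] \<in> traces (E \<parallel>\<^sub>E F) \<and> label (E \<parallel>\<^sub>E F) y s \<noteq> {}"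
  proof (cases x)
    case (Inl e)
    with * have "lefts \<alpha> @ [e] \<in> traces E" "rights \<alpha> \<in> traces F"
      by (auto simp: traces_par)
    moreover obtain e' where "lefts \<alpha> @ [e'] \<in> traces E" "label E e' s \<noteq> {}"
      using assms(1) calculation(1) unfolding feasible_iff by blast
    ultimately show ?thesis
      by (intro exI[of _ "Inl e'"]) (auto simp: traces_par, simp add: par_def)
  next
    case (Inr e)
    with * have "rights \<alpha> @ [e] \<in> traces F" "lefts \<alpha> \<in> traces E"
      by (auto simp: traces_par)
    moreover obtain e' where "rights \<alpha> @ [e'] \<in> traces F" "label F e' s \<noteq> {}"
      using assms(2) calculation(1) unfolding feasible_iff by blast
    ultimately show ?thesis
      by (intro exI[of _ "Inr e'"]) (auto simp: traces_par, simp add: par_def)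
  qed
qed

text \<open>A disabled event can be exchanged for an enabled one of the same operand, since the exit
  condition depends only on the past of the first operand.\<close>

lemma feasible_seq:
  assumes "feasible E" "feasible F"
  shows "feasible (E \<cdot>\<^sub>E F)"
  unfolding feasible_iff
proof (intro allI impI)
  fix \<alpha> x s assume *: "\<alpha> @ [x] \<in> traces (E \<cdot>\<^sub>E F)"
  show "\<exists>y. \<alpha> @ [y] \<in> traces (E \<cdot>\<^sub>E F) \<and> label (E \<cdot>\<^sub>E F) y s \<noteq> {}"
  proof (cases x)
    case (Inl e)
    with * have "lefts \<alpha> @ [e] \<in> traces E" "\<alpha> \<in> traces (E \<cdot>\<^sub>E F)"
      by (auto simp: traces_seq_Inl)
    moreover obtain e' where "lefts \<alpha> @ [e'] \<in> traces E" "label E e' s \<noteq> {}"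
      using assms(1) calculation(1) unfolding feasible_iff by blast
    ultimately show ?thesis
      by (intro exI[of _ "Inl e'"]) (auto simp: traces_seq_Inl, simp add: seq_def)
  next
    case (Inr e)
    with * have "rights \<alpha> @ [e] \<in> traces F" "\<alpha> \<in> traces (E \<cdot>\<^sub>E F)" "exits_hit E (lefts \<alpha>)"
      by (auto simp: traces_seq_Inr)
    moreover obtain e' where "rights \<alpha> @ [e'] \<in> traces F" "label F e' s \<noteq> {}"
      using assms(2) calculation(1) unfolding feasible_iff by blast
    ultimately show ?thesis
      by (intro exI[of _ "Inr e'"]) (auto simp: traces_seq_Inr, simp add: seq_def)
  qed
qed

context
  fixes c :: "'e list \<Rightarrow> nat"
begin

definition rely_count :: "('p + star_event + 'd + 'e) list \<Rightarrow> nat" where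
  "rely_count \<gamma> = num_acts (lefts (rights \<gamma>)) + c (rights (rights (rights \<gamma>)))"

text \<open>The image of a trace grows at its end, so the recursion runs over the reversed list. The
  actions are numbered by the current count, which makes the rely part of the image
  \<open>Act 0\<close>, \<open>Act 1\<close>, and so on without gaps.\<close>

primrec absorb_rev :: "('p + star_event + 'd + 'e) list \<Rightarrow> ('p + star_event + 'd) list" where
  "absorb_rev [] = []"
| "absorb_rev (x # xs) = absorb_rev xs @
     (let act = (if rely_count (rev (x # xs)) = rely_count (rev xs) then []
                 else [Inr (Inl (Act (rely_count (rev xs))))])
      in case x of Inl p \<Rightarrow> [Inl p]
         | Inr y \<Rightarrow> (case y of Inl a \<Rightarrow> act
             | Inr z \<Rightarrow> (case z of Inl d \<Rightarrow> [Inr (Inr d)] | Inr e \<Rightarrow> act)))"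

definition absorb :: "('p + star_event + 'd + 'e) list \<Rightarrow> ('p + star_event + 'd) list" where
  "absorb \<gamma> = absorb_rev (rev \<gamma>)"

end

lemma absorb_simps:
  "absorb c [] = []"
  "absorb c (\<gamma> @ [Inl p]) = absorb c \<gamma> @ [Inl p]"
  "absorb c (\<gamma> @ [Inr (Inr (Inl d))]) = absorb c \<gamma> @ [Inr (Inr d)]"
  "absorb c (\<gamma> @ [Inr (Inl a)]) = absorb c \<gamma> @
     (if rely_count c (\<gamma> @ [Inr (Inl a)]) = rely_count c \<gamma> then [] else [Inr (Inl (Act (rely_count c \<gamma>)))])"
  "absorb c (\<gamma> @ [Inr (Inr (Inr e))]) = absorb c \<gamma> @
     (if rely_count c (\<gamma> @ [Inr (Inr (Inr e))]) = rely_count c \<gamma> then [] else [Inr (Inl (Act (rely_count c \<gamma>)))])"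
  by (simp_all add: absorb_def)

text \<open>The visible steps of \<open>star r\<close> and of \<open>E\<close> are both steps that
  \<open>r'\<close> allows, so together they form one run of \<open>star r'\<close>.
  \<open>P\<close> and \<open>D\<close> are copied, and invisible steps, including each
  \<open>Done\<close> of \<open>star r\<close>, disappear.\<close>

lemma par_star_absorb:
  fixes P :: "('p, 's::finite) ipbes" and D :: "('d, 's) ipbes" and E :: "('e, 's) ipbes"
  assumes P: "feasible P" "\<And>e. e \<in> events P \<Longrightarrow> label P e \<in> H1_bar"
    and D: "feasible D" "\<And>e. e \<in> events D \<Longrightarrow> label D e \<in> H1_bar"
    and r': "r' \<in> H1" "r \<sqsubseteq>\<^sub>H r'"
    and c: "step_count E r' c"
  shows "P \<cdot>\<^sub>E (star r \<parallel>\<^sub>E (D \<parallel>\<^sub>E E)) \<sqsubseteq> P \<cdot>\<^sub>E (star r' \<parallel>\<^sub>E D)"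
proof -
  define A where "A = P \<cdot>\<^sub>E (star r \<parallel>\<^sub>E (D \<parallel>\<^sub>E E))"
  define B where "B = P \<cdot>\<^sub>E (star r' \<parallel>\<^sub>E D)"
  define f where "f = (absorb c :: ('p + star_event + 'd + 'e) list \<Rightarrow> _)"
  define k where "k = (rely_count c :: ('p + star_event + 'd + 'e) list \<Rightarrow> _)"
  have f_simps: "f [] = []"
    "f (\<gamma> @ [Inl p]) = f \<gamma> @ [Inl p]"
    "f (\<gamma> @ [Inr (Inr (Inl d))]) = f \<gamma> @ [Inr (Inr d)]"
    "f (\<gamma> @ [Inr (Inl a)]) = f \<gamma> @
       (if k (\<gamma> @ [Inr (Inl a)]) = k \<gamma> then [] else [Inr (Inl (Act (k \<gamma>)))])"
    "f (\<gamma> @ [Inr (Inr (Inr e))]) = f \<gamma> @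
       (if k (\<gamma> @ [Inr (Inr (Inr e))]) = k \<gamma> then [] else [Inr (Inl (Act (k \<gamma>)))])"
    for \<gamma> p d a e
    unfolding f_def k_def by (rule absorb_simps)+
  have A_Inl: "\<gamma> @ [Inl p] \<in> traces A \<longleftrightarrow> \<gamma> \<in> traces A \<and> lefts \<gamma> @ [p] \<in> traces P" for \<gamma> p
    by (simp add: A_def traces_seq_Inl)
  have B_Inl: "\<gamma> @ [Inl p] \<in> traces B \<longleftrightarrow> \<gamma> \<in> traces B \<and> lefts \<gamma> @ [p] \<in> traces P" for \<gamma> p
    by (simp add: B_def traces_seq_Inl)
  have A_parts: "lefts \<gamma> \<in> traces P" "lefts (rights \<gamma>) \<in> traces (star r)"
    "lefts (rights (rights \<gamma>)) \<in> traces D" "rights (rights (rights \<gamma>)) \<in> traces E"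
    if "\<gamma> \<in> traces A" for \<gamma>
    using traces_seqD[OF that[unfolded A_def]] by (auto simp: traces_par)
  have B_parts: "lefts (rights \<gamma>) \<in> traces (star r')" "rights (rights \<gamma>) \<in> traces D"
    if "\<gamma> \<in> traces B" for \<gamma>
    using traces_seqD[OF that[unfolded B_def]] by (auto simp: traces_par)
  have A_Inr: "\<gamma> @ [Inr (Inl a)] \<in> traces A \<longleftrightarrow>
      \<gamma> \<in> traces A \<and> lefts (rights \<gamma>) @ [a] \<in> traces (star r) \<and> exits_hit P (lefts \<gamma>)"
    "\<gamma> @ [Inr (Inr (Inl d))] \<in> traces A \<longleftrightarrow>
      \<gamma> \<in> traces A \<and> lefts (rights (rights \<gamma>)) @ [d] \<in> traces D \<and> exits_hit P (lefts \<gamma>)"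
    "\<gamma> @ [Inr (Inr (Inr e))] \<in> traces A \<longleftrightarrow>
      \<gamma> \<in> traces A \<and> rights (rights (rights \<gamma>)) @ [e] \<in> traces E \<and> exits_hit P (lefts \<gamma>)"
    for \<gamma> a d e
    using A_parts[of \<gamma>] by (auto simp: A_def traces_seq_Inr traces_par)
  have B_Inr: "\<gamma> @ [Inr (Inl a)] \<in> traces B \<longleftrightarrow>
      \<gamma> \<in> traces B \<and> lefts (rights \<gamma>) @ [a] \<in> traces (star r') \<and> exits_hit P (lefts \<gamma>)"
    "\<gamma> @ [Inr (Inr d)] \<in> traces B \<longleftrightarrow>
      \<gamma> \<in> traces B \<and> rights (rights \<gamma>) @ [d] \<in> traces D \<and> exits_hit P (lefts \<gamma>)"
    for \<gamma> a d
    using B_parts[of \<gamma>] by (auto simp: B_def traces_seq_Inr traces_par)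
  have k_simps: "k [] = 0" "k (\<gamma> @ [Inl p]) = k \<gamma>" "k (\<gamma> @ [Inr (Inr (Inl d))]) = k \<gamma>" for \<gamma> p d
    using c by (auto simp: k_def rely_count_def step_count_def)
  have k_star: "k (\<gamma> @ [Inr (Inl a)]) = k \<gamma> \<and> label A (Inr (Inl a)) \<sqsubseteq>\<^sub>H skip \<or>
      k (\<gamma> @ [Inr (Inl a)]) = Suc (k \<gamma>) \<and> label A (Inr (Inl a)) \<sqsubseteq>\<^sub>H r'" for \<gamma> a
    using r'(2) by (cases a) (auto simp: k_def rely_count_def A_def seq_def par_def H_le_def)
  have k_E: "k (\<gamma> @ [Inr (Inr (Inr e))]) = k \<gamma> \<and> label A (Inr (Inr (Inr e))) \<sqsubseteq>\<^sub>H skip \<or>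
      k (\<gamma> @ [Inr (Inr (Inr e))]) = Suc (k \<gamma>) \<and> label A (Inr (Inr (Inr e))) \<sqsubseteq>\<^sub>H r'"
    if "\<gamma> @ [Inr (Inr (Inr e))] \<in> traces A" for \<gamma> e
  proof -
    have "rights (rights (rights \<gamma>)) @ [e] \<in> traces E"
      using that A_Inr by blast
    then have "c (rights (rights (rights \<gamma>)) @ [e]) = c (rights (rights (rights \<gamma>))) \<and> label E e \<sqsubseteq>\<^sub>H skip \<or>
      c (rights (rights (rights \<gamma>)) @ [e]) = Suc (c (rights (rights (rights \<gamma>)))) \<and> label E e \<sqsubseteq>\<^sub>H r'"
      using c unfolding step_count_def by blast
    then show ?thesis
      by (auto simp: k_def rely_count_def A_def seq_def par_def)
  qed
  have f_outer: "lefts (f \<gamma>) = lefts \<gamma> \<and> rights (rights (f \<gamma>)) = lefts (rights (rights \<gamma>))" for \<gamma>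
  proof (induction \<gamma> rule: rev_induct)
    case (snoc x \<gamma>)
    consider p where "x = Inl p" | a where "x = Inr (Inl a)" | d where "x = Inr (Inr (Inl d))"
      | e where "x = Inr (Inr (Inr e))"
      by (metis sum.exhaust)
    then show ?case
      using snoc by cases (simp_all add: f_simps)
  qed (simp add: f_simps)
  \<comment> \<open>The rely part of the image never contains \<open>Done\<close>: the next action
    is thus always free of conflicts, and the rely can still be closed at the end.\<close>
  have f_traces: "f \<gamma> \<in> traces B \<and> lefts (rights (f \<gamma>)) = acts (k \<gamma>)" if "\<gamma> \<in> traces A" for \<gamma>
    using that
  proof (induction \<gamma> rule: rev_induct)
    case (snoc x \<gamma>)
    then have IH: "f \<gamma> \<in> traces B" "lefts (rights (f \<gamma>)) = acts (k \<gamma>)"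
      using traces_appendD by blast+
    consider p where "x = Inl p" | a where "x = Inr (Inl a)" | d where "x = Inr (Inr (Inl d))"
      | e where "x = Inr (Inr (Inr e))"
      by (metis sum.exhaust)
    then show ?case
    proof cases
      case 1
      with snoc.prems IH f_outer[of \<gamma>] show ?thesis
        by (simp add: f_simps k_simps A_Inl B_Inl)
    next
      case 2
      with snoc.prems IH f_outer[of \<gamma>] k_star[of \<gamma> a] show ?thesis
        by (auto simp: f_simps A_Inr B_Inr acts_snoc_in_star_traces)
    next
      case 3
      with snoc.prems IH f_outer[of \<gamma>] show ?thesis
        by (simp add: f_simps k_simps A_Inr B_Inr)
    next
      case 4
      with snoc.prems IH f_outer[of \<gamma>] k_E[of \<gamma> e] show ?thesis
        by (auto simp: f_simps A_Inr B_Inr acts_snoc_in_star_traces)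
    qed
  qed (simp add: f_simps k_simps)
  have "weak_simulation A B f"
  proof
    show "f \<gamma> \<in> traces B" if "\<gamma> \<in> traces A" for \<gamma>
      using f_traces[OF that] by blast
    show "f [] = []"
      by (simp add: f_simps)
    show "finite {\<gamma> \<in> traces A. f \<gamma> = \<beta>}" for \<beta>
    proof (rule finite_subset)
      \<comment> \<open>The image fixes the events of \<open>P\<close> and \<open>D\<close> and
        their order, and bounds by \<open>n\<close> both the actions of \<open>star r\<close> and
        the count of \<open>E\<close>.\<close>
      define n where "n = length (lefts (rights \<beta>))"
      let ?R = "{\<alpha> \<in> traces (star r). num_acts \<alpha> \<le> n}"
      let ?E = "{\<alpha> \<in> traces E. c \<alpha> \<le> n}"
      let ?DE = "{\<alpha>. lefts \<alpha> \<in> {rights (rights \<beta>)} \<and> rights \<alpha> \<in> ?E}"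
      let ?F = "{\<alpha>. lefts \<alpha> \<in> ?R \<and> rights \<alpha> \<in> ?DE}"
      let ?G = "{\<alpha>. lefts \<alpha> \<in> {lefts \<beta>} \<and> rights \<alpha> \<in> ?F}"
      show "{\<gamma> \<in> traces A. f \<gamma> = \<beta>} \<subseteq> ?G"
      proof
        fix \<gamma> assume "\<gamma> \<in> {\<gamma> \<in> traces A. f \<gamma> = \<beta>}"
        then have \<gamma>: "\<gamma> \<in> traces A" "\<beta> = f \<gamma>" by auto
        have "k \<gamma> = n"
          using f_traces[OF \<gamma>(1)] by (simp add: n_def \<gamma>(2))
        then show "\<gamma> \<in> ?G"
          using A_parts[OF \<gamma>(1)] f_outer[of \<gamma>] by (auto simp: k_def rely_count_def \<gamma>(2))
      qed
      show "finite ?G"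
        by (intro finite_interleavings step_count_finite_le[OF c] step_count_finite_le[OF step_count_star]) auto
    qed
    show "f (\<gamma> @ [x]) = f \<gamma> \<and> label A x \<sqsubseteq>\<^sub>H skip \<or>
        (\<exists>e'. label A x \<sqsubseteq>\<^sub>H label B e' \<and> f (\<gamma> @ [x]) = f \<gamma> @ [e'])"
      if x: "\<gamma> @ [x] \<in> traces A" for \<gamma> x
    proof -
      have act: "label B (Inr (Inl (Act n))) = r'" for n
        by (simp add: B_def seq_def par_def)
      consider p where "x = Inl p" | a where "x = Inr (Inl a)" | d where "x = Inr (Inr (Inl d))"
        | e where "x = Inr (Inr (Inr e))"
        by (metis sum.exhaust)
      then show ?thesis
      proof cases
        case 1
        have "label A (Inl p) = label B (Inl p)"
          by (simp add: A_def B_def seq_def)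
        then show ?thesis
          by (auto simp: 1 f_simps H_le_def)
      next
        case 2
        with k_star[of \<gamma> a] show ?thesis
          by (auto simp: f_simps act)
      next
        case 3
        have "label A (Inr (Inr (Inl d))) = label B (Inr (Inr d))"
          by (simp add: A_def B_def seq_def par_def)
        then show ?thesis
          by (auto simp: 3 f_simps H_le_def)
      next
        case 4
        with k_E[of \<gamma> e] x show ?thesis
          by (auto simp: f_simps act)
      qed
    qed
    show "f \<gamma> \<in> max_traces B \<or> (\<exists>d. f \<gamma> @ [d] \<in> max_traces B \<and> skip \<sqsubseteq>\<^sub>H label B d)"
      if "\<gamma> \<in> max_traces A" for \<gamma>
    proof -
      have \<gamma>: "\<gamma> \<in> traces A" "\<And>x. \<gamma> @ [x] \<notin> traces A"
        using that by (auto simp: max_traces_iff)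
      note f = f_traces[OF \<gamma>(1)] f_outer[of \<gamma>]
      have no_P: "lefts \<gamma> @ [p] \<notin> traces P" for p
        using \<gamma>(1) \<gamma>(2)[of "Inl p"] by (simp add: A_Inl)
      show ?thesis
      proof (cases "exits_hit P (lefts \<gamma>)")
        case True
        have no_D: "lefts (rights (rights \<gamma>)) @ [d] \<notin> traces D" for d
          using \<gamma>(1) \<gamma>(2)[of "Inr (Inr (Inl d))"] True by (simp add: A_Inr)
        \<comment> \<open>\<open>P\<close> and \<open>D\<close> are stuck as well, so closing the
          still open rely completes the image.\<close>
        let ?d = "Inr (Inl (Done (k \<gamma>)))"
        have "f \<gamma> @ [?d] \<in> traces B"
          using f True by (simp add: B_Inr acts_snoc_in_star_traces)
        moreover have "(f \<gamma> @ [?d]) @ [x] \<notin> traces B" for x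
        proof -
          consider p where "x = Inl p" | a where "x = Inr (Inl a)" | d where "x = Inr (Inr d)"
            by (metis sum.exhaust)
          then show ?thesis
          proof cases
            case 2
            have "(acts (k \<gamma>) @ [Done (k \<gamma>)]) @ [a] \<notin> traces (star r')"
              using acts_Done_in_star_max_traces[of "k \<gamma>" r'] unfolding max_traces_iff by blast
            then show ?thesis
              unfolding 2 B_Inr using f by simp
          qed (use f no_P no_D in \<open>simp_all only: B_Inl B_Inr, simp_all\<close>)
        qed
        ultimately have "f \<gamma> @ [?d] \<in> max_traces B"
          unfolding max_traces_iff by blast
        moreover have "label B ?d = skip"
          by (simp add: B_def seq_def par_def)
        ultimately show ?thesis
          by (intro disjI2 exI[of _ ?d]) (simp add: H_le_def)
      next
        case False
        \<comment> \<open>\<open>P\<close> is stuck without having hit its exits, so nothing behind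
          it can start and the image is already maximal.\<close>
        have "f \<gamma> @ [x] \<notin> traces B" for x
        proof -
          consider p where "x = Inl p" | a where "x = Inr (Inl a)" | d where "x = Inr (Inr d)"
            by (metis sum.exhaust)
          then show ?thesis
            using f no_P False by cases (simp_all add: B_Inl B_Inr)
        qed
        with f show ?thesis
          unfolding max_traces_iff by blast
      qed
    qed
    have "label (star r' \<parallel>\<^sub>E D) e \<in> H1_bar" if "e \<in> events (star r' \<parallel>\<^sub>E D)" for e
      by (rule labels_par[OF labels_star[OF r'(1)] D(2) that])
    then show "label B e \<in> H1_bar" if "e \<in> events B" for e
      using that P(2) unfolding B_def by (intro labels_seq) blast+
    show "feasible B"
      unfolding B_def by (intro feasible_seq feasible_par feasible_star P D r')
  qed
  then show ?thesis
    unfolding A_def B_def by (rule weak_simulation.sem_le)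
qed

theorem proposition6p1:
  fixes P :: "('p, 's::finite) ipbes"
    and E1 :: "('e1, 's) ipbes" and E2 :: "('e2, 's) ipbes"
    and Q1 :: "('q1, 's) ipbes" and Q2 :: "('q2, 's) ipbes"
    and r1 r2 g1 g2 :: "'s prog"
  assumes "prob_concurrent_program P"
    and "prob_concurrent_program E1" and "prob_concurrent_program E2"
    and "prob_concurrent_program Q1" and "prob_concurrent_program Q2"
    and "r1 \<in> H1" and "r2 \<in> H1" and "g1 \<in> H1" and "g2 \<in> H1"
    and "(\<lambda>s. r1 s \<inter> r2 s) \<in> H1"
    and "rg_quintuple P (star r1) E1 (star g1) Q1"
    and "rg_quintuple P (star r2) E2 (star g2) Q2"
    and "g1 \<sqsubseteq>\<^sub>H r2" and "g2 \<sqsubseteq>\<^sub>H r1"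
  shows "rg_quintuple P (star (\<lambda>s. r1 s \<inter> r2 s)) (E1 \<parallel>\<^sub>E E2) (star (g1 +\<^sub>H g2)) Q1"
proof -
  have "E1 \<sqsubseteq>\<^sub>s\<^sub>i\<^sub>m star g1" "E2 \<sqsubseteq>\<^sub>s\<^sub>i\<^sub>m star g2"
    using assms(11,12) unfolding rg_quintuple_def by blast+
  then obtain c1 c2 where c: "step_count E1 g1 c1" "step_count E2 g2 c2"
    using step_count_if_simulation unfolding sim_le_def by metis
  \<comment> \<open>\<open>E2\<close> plays the part of the environment of \<open>E1\<close>: its
    visible steps lie below \<open>g2\<close> and hence below \<open>r1\<close>, as does the
    intersection of the relies.\<close>
  have "P \<cdot>\<^sub>E (star (\<lambda>s. r1 s \<inter> r2 s) \<parallel>\<^sub>E (E1 \<parallel>\<^sub>E E2)) \<sqsubseteq> P \<cdot>\<^sub>E (star r1 \<parallel>\<^sub>E E1)"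
    using assms(1,2,6) step_count_mono[OF c(2) assms(14)]
    by (intro par_star_absorb) (auto simp: prob_concurrent_program_def is_ipbes_def H_le_def)
  moreover have "P \<cdot>\<^sub>E (star r1 \<parallel>\<^sub>E E1) \<sqsubseteq> Q1"
    using assms(11) unfolding rg_quintuple_def by blast
  ultimately have "P \<cdot>\<^sub>E (star (\<lambda>s. r1 s \<inter> r2 s) \<parallel>\<^sub>E (E1 \<parallel>\<^sub>E E2)) \<sqsubseteq> Q1"
    unfolding sem_le_def H_le_def by blast
  moreover have "E1 \<parallel>\<^sub>E E2 \<sqsubseteq>\<^sub>s\<^sub>i\<^sub>m star (g1 +\<^sub>H g2)"
    using c H_choice_upper[OF assms(8,9)]
    by (intro sim_le_star_if_step_count[OF step_count_par]) (auto intro: step_count_mono)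
  ultimately show ?thesis
    unfolding rg_quintuple_def by blast
qed

end
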